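(* Let $(y^k,z^k,\lambda^k)_{k\ge1}$ be generated by the IADMM algorithm described in the context, where $g$ is strongly convex with parameter $\sigma_g>0$. Suppose there is a symmetric positive definite matrix $\Theta\succ0$ such that $\beta_kP_k+\beta_k^2B^\top B\succeq\Theta$ for all $k$. Then $(y^k,z^k,\lambda^k)$ converges, as $k\to\infty$, to a KKT solution $(y^*,z^*,\lambda^* )$ of the problem $\min\{f(y)+g(z): By+Cz=b\}$.
   Context: Problem: $\min\{f(y)+g(z): By+Cz=b\}$, where $B\in\mathbb R^{m\times n_1}$, $C\in\mathbb R^{m\times n_2}$, $b\in\mathbb R^m$, and $f:\mathbb R^{n_1}\to(-\infty,\infty]$, $g:\mathbb R^{n_2}\to(-\infty,\infty]$ are proper, lower semicontinuous and convex. The function $g$ is strongly convex with parameter $\sigma_g>0$: $g(x)-g(y)\ge\langle\xi,x-y\rangle+\frac{\sigma_g}{2}\|x-y\|^2$ for all $x,y\in\mathbb R^{n_2}$ and all $\xi\in\partial g(y)$. A triple $(y,z,\lambda)$ is a KKT solution if $0\in\partial f(y)+B^\top\lambda$, $0\in\partial g(z)+C^\top\lambda$ and $By+Cz-b=0$. The set of KKT solutions is assumed nonempty. $\|\cdot\|$ is the Euclidean norm; for a symmetric positive semidefinite matrix $D$, $\|w\|_D=\sqrt{\langle w,Dw\rangle}$; $\succeq,\preceq,\succ$ denote the Loewner order. IADMM algorithm: choose $x^1=(y^1,z^1)$, $\lambda^1$, constants $\gamma\in(1,\frac{1+\sqrt5}{2})$ and $\epsilon,\beta,\tau\in(0,1)$,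 an initial penalty $\beta_1\in[\beta,\infty)$, a symmetric matrix $Q\succeq0$, and symmetric matrices $P_k\succeq0$ $(k\ge1)$ with $\beta_{k+1}P_{k+1}\preceq\beta_kP_k$ for all $k\ge1$; set $Q_k=\beta_kQ$. It is assumed that $\lambda_{\max}(C^\top C+Q)>0$. For $k=1,2,\dots$: 1. $y^{k+1}\in\arg\min_y\{f(y)+\langle\lambda^k,By\rangle+\frac{\beta_k}{2}\|By+Cz^k-b\|^2+\frac12\|y-y^k\|^2_{P_k}\}$; 2. $z^{k+1}\in\arg\min_z\{g(z)+\langle\lambda^k,Cz\rangle+\frac{\beta_k}{2}\|By^{k+1}+Cz-b\|^2+\frac12\|z-z^k\|^2_{Q_k}\}$; 3. $\lambda^{k+1}=\lambda^k+\gamma\beta_k(By^{k+1}+Cz^{k+1}-b)$; 4. choose any $\beta_{k+1}\in\left[\max\{\beta,\tau\beta_k\},\ \sqrt{\beta_k^2+\frac{(1-\epsilon)\sigma_g\beta_k}{\lambda_{\max}(C^\top C+Q)}}\right]$. Every subproblem is assumed to be well-defined with an optimal solution. *)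

theory Defs
  imports "HOL-Analysis.Analysis"
begin

section \<open>Extended-real-valued convex functions\<close>

definition proper_fun :: "('a \<Rightarrow> ereal) \<Rightarrow> bool" where
  "proper_fun f \<longleftrightarrow> (\<forall>x. f x \<noteq> -\<infinity>) \<and> (\<exists>x. f x \<noteq> \<infinity>)"

definition lsc_fun :: "('a::topological_space \<Rightarrow> ereal) \<Rightarrow> bool" where
  "lsc_fun f \<longleftrightarrow> (\<forall>x. f x \<le> Liminf (at x) f)"

text \<open>The weights are strictly between 0 and 1. For functions that avoid \<open>-\<infinity>\<close>
  (all functions considered here) the right-hand side is never of the form \<open>\<infinity> - \<infinity>\<close>.\<close>

definition convex_fun :: "('a::real_vector \<Rightarrow> ereal) \<Rightarrow> bool" where
  "convex_fun f \<longleftrightarrow>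
     (\<forall>x y t. 0 < t \<and> t < 1 \<longrightarrow>
        f ((1 - t) *\<^sub>R x + t *\<^sub>R y) \<le> ereal (1 - t) * f x + ereal t * f y)"

text \<open>For proper \<open>f\<close> this set is empty at every point outside the effective domain.\<close>

definition subdiff :: "('a::real_inner \<Rightarrow> ereal) \<Rightarrow> 'a \<Rightarrow> 'a set" where
  "subdiff f x = {\<xi>. \<forall>y. f y \<ge> f x + ereal (\<xi> \<bullet> (y - x))}"

text \<open>For proper \<open>g\<close> the value \<open>g y\<close> below is finite, since \<open>\<xi> \<in> subdiff g y\<close>; hence
  the difference is the ordinary one.\<close>

definition strongly_convex_fun :: "real \<Rightarrow> ('a::real_inner \<Rightarrow> ereal) \<Rightarrow> bool" where
  "strongly_convex_fun \<sigma> g \<longleftrightarrow>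
     (\<forall>x y. \<forall>\<xi>\<in>subdiff g y.
        g x - g y \<ge> ereal (\<xi> \<bullet> (x - y) + \<sigma> / 2 * (norm (x - y))\<^sup>2))"

section \<open>Symmetric matrices\<close>

definition pos_semidef :: "real^'n^'n \<Rightarrow> bool" where
  "pos_semidef D \<longleftrightarrow> transpose D = D \<and> (\<forall>w. w \<bullet> (D *v w) \<ge> 0)"

definition pos_def :: "real^'n^'n \<Rightarrow> bool" where
  "pos_def D \<longleftrightarrow> transpose D = D \<and> (\<forall>w. w \<noteq> 0 \<longrightarrow> w \<bullet> (D *v w) > 0)"

definition loewner_le :: "real^'n^'n \<Rightarrow> real^'n^'n \<Rightarrow> bool" where
  "loewner_le D E \<longleftrightarrow> pos_semidef (E - D)"

definition weighted_norm :: "real^'n^'n \<Rightarrow> real^'n \<Rightarrow> real" where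
  "weighted_norm D w = sqrt (w \<bullet> (D *v w))"

text \<open>Only real eigenvalues are considered. For symmetric \<open>D\<close> these are all the eigenvalues,
  and they form a finite nonempty set, so that the maximum is meaningful.\<close>

definition eigenvalues :: "real^'n^'n \<Rightarrow> real set" where
  "eigenvalues D = {c. \<exists>v. v \<noteq> 0 \<and> D *v v = c *\<^sub>R v}"

definition lambda_max :: "real^'n^'n \<Rightarrow> real" where
  "lambda_max D = Max (eigenvalues D)"

section \<open>KKT solutions and the IADMM algorithm\<close>

definition kkt_solution ::
  "(real^'p \<Rightarrow> ereal) \<Rightarrow> (real^'q \<Rightarrow> ereal) \<Rightarrow> real^'p^'m \<Rightarrow> real^'q^'m \<Rightarrow> real^'m \<Rightarrow>
   (real^'p) \<times> (real^'q) \<times> (real^'m) \<Rightarrow> bool" where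
  "kkt_solution f g B C b = (\<lambda>(y, z, l).
     0 \<in> (\<lambda>\<xi>. \<xi> + transpose B *v l) ` subdiff f y \<and>
     0 \<in> (\<lambda>\<xi>. \<xi> + transpose C *v l) ` subdiff g z \<and>
     B *v y + C *v z - b = 0)"

definition iadmm_y_objective ::
  "(real^'p \<Rightarrow> ereal) \<Rightarrow> real^'p^'m \<Rightarrow> real^'q^'m \<Rightarrow> real^'m \<Rightarrow>
   real \<Rightarrow> real^'p^'p \<Rightarrow> real^'p \<Rightarrow> real^'q \<Rightarrow> real^'m \<Rightarrow> real^'p \<Rightarrow> ereal" where
  "iadmm_y_objective f B C b \<beta> P yk zk lk y =
     f y + ereal (lk \<bullet> (B *v y) + \<beta> / 2 * (norm (B *v y + C *v zk - b))\<^sup>2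
                  + 1 / 2 * (weighted_norm P (y - yk))\<^sup>2)"

definition iadmm_z_objective ::
  "(real^'q \<Rightarrow> ereal) \<Rightarrow> real^'p^'m \<Rightarrow> real^'q^'m \<Rightarrow> real^'m \<Rightarrow>
   real \<Rightarrow> real^'q^'q \<Rightarrow> real^'p \<Rightarrow> real^'q \<Rightarrow> real^'m \<Rightarrow> real^'q \<Rightarrow> ereal" where
  "iadmm_z_objective g B C b \<beta> Q ynext zk lk z =
     g z + ereal (lk \<bullet> (C *v z) + \<beta> / 2 * (norm (B *v ynext + C *v z - b))\<^sup>2
                  + 1 / 2 * (weighted_norm Q (z - zk))\<^sup>2)"

text \<open>All sequences are indexed from 1; their values at index 0 are irrelevant. The real
  number \<open>\<beta>low\<close> is the fixed lower bound on the penalty parameters \<open>\<beta> k\<close>.\<close>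

definition iadmm_sequence ::
  "(real^'p \<Rightarrow> ereal) \<Rightarrow> (real^'q \<Rightarrow> ereal) \<Rightarrow> real^'p^'m \<Rightarrow> real^'q^'m \<Rightarrow> real^'m \<Rightarrow>
   real \<Rightarrow> real \<Rightarrow> real \<Rightarrow> real \<Rightarrow> real \<Rightarrow> real^'q^'q \<Rightarrow> (nat \<Rightarrow> real^'p^'p) \<Rightarrow>
   (nat \<Rightarrow> real) \<Rightarrow> (nat \<Rightarrow> real^'p) \<Rightarrow> (nat \<Rightarrow> real^'q) \<Rightarrow> (nat \<Rightarrow> real^'m) \<Rightarrow> bool" where
  "iadmm_sequence f g B C b \<sigma>\<^sub>g \<gamma> \<epsilon> \<beta>low \<tau> Q P \<beta> y z l \<longleftrightarrow>
     \<gamma> \<in> {1<..<(1 + sqrt 5) / 2} \<and> \<epsilon> \<in> {0<..<1} \<and> \<beta>low \<in> {0<..<1} \<and> \<tau> \<in> {0<..<1} \<and>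
     \<beta> 1 \<in> {\<beta>low..} \<and>
     pos_semidef Q \<and>
     (\<forall>k\<ge>1. pos_semidef (P k)) \<and>
     (\<forall>k\<ge>1. loewner_le (\<beta> (k + 1) *\<^sub>R P (k + 1)) (\<beta> k *\<^sub>R P k)) \<and>
     (\<forall>k\<ge>1.
        is_arg_min (iadmm_y_objective f B C b (\<beta> k) (P k) (y k) (z k) (l k))
          (\<lambda>_. True) (y (k + 1)) \<and>
        is_arg_min (iadmm_z_objective g B C b (\<beta> k) (\<beta> k *\<^sub>R Q) (y (k + 1)) (z k) (l k))
          (\<lambda>_. True) (z (k + 1)) \<and>
        l (k + 1) = l k + (\<gamma> * \<beta> k) *\<^sub>R (B *v y (k + 1) + C *v z (k + 1) - b) \<and>
        \<beta> (k + 1) \<in> {max \<beta>low (\<tau> * \<beta> k) ..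
                     sqrt ((\<beta> k)\<^sup>2 + (1 - \<epsilon>) * \<sigma>\<^sub>g * \<beta> k
                                        / lambda_max (transpose C ** C + Q))})"

end

theory Submission
  imports Defs
begin

text \<open>
  The proof follows a Lyapunov function. For a KKT point \<open>(y\<^sup>*, z\<^sup>*, \<lambda>\<^sup>*)\<close> and \<open>D = C\<^sup>T C + Q\<close> the energy consists of
  \<open>\<parallel>\<lambda> - \<lambda>\<^sup>*\<parallel>\<^sup>2 / \<gamma> + \<beta> \<parallel>y - y\<^sup>*\<parallel>\<^sub>P\<^sup>2 + \<beta>\<^sup>2 \<parallel>z - z\<^sup>*\<parallel>\<^sub>D\<^sup>2\<close> and two correction terms. Monotonicity of the subdifferentials
  (\<open>one_step_inequality\<close>) makes it decrease, provided two obstacles are overcome. A mixed term of the step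
  in \<open>z\<close> and the new residual has no sign; it is absorbed with the help of the previous optimality condition
  for \<open>z\<close>, which works as long as \<open>\<gamma>\<close> is below the golden ratio (\<open>cross_term_bound\<close>). And the weight
  \<open>\<beta>\<^sup>2\<close> may increase; the rule for \<open>\<beta>\<close> limits the increase to what the strong convexity of \<open>g\<close> pays for
  (\<open>\<beta>_growth\<close>). The result is \<open>energy_descent\<close>.

  Summing the decreases shows that \<open>z\<close> converges to \<open>z\<^sup>*\<close> and that the optimality conditions of the subproblems
  tend to the KKT conditions (\<open>tendsto_zero_parts\<close>). The energy bounds the distance of \<open>y\<close> and \<open>\<lambda>\<close> to the KKT
  point (\<open>energy_controls_iterates\<close>); for \<open>y\<close> this uses \<open>\<Theta>\<close>. So there are cluster points, and they are
  KKT points because the graphs of the subdifferentials are closed (\<open>kkt_cluster_point\<close>).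

  It remains to see that the energy with respect to one such cluster point tends to zero. It is monotone, so a
  subsequence suffices. All its terms are harmless except \<open>\<beta>\<^sup>2 \<parallel>z - z\<^sup>*\<parallel>\<^sub>D\<^sup>2\<close>, because \<open>\<beta>\<close> may be unbounded and
  only \<open>\<beta> \<parallel>z - z\<^sup>*\<parallel>\<^sup>2\<close> is known to be summable. But \<open>\<beta>\<close> grows at most linearly, so \<open>1 / \<beta>\<close> is not
  summable, and therefore \<open>\<beta>\<^sup>2 \<parallel>z - z\<^sup>*\<parallel>\<^sup>2\<close> has zero as a cluster value
  (\<open>weighted_z_error_subsequence\<close>). The cluster point is taken along a subsequence realizing it.
\<close>

section \<open>Symmetric matrices\<close>

text \<open>The quadratic form \<open>\<parallel>w\<parallel>\<^sub>D\<^sup>2\<close> is used instead of \<open>weighted_norm D w\<close>: it needs no square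
  root, and it is linear in \<open>D\<close>.\<close>

abbreviation quad :: "real^'n^'n \<Rightarrow> real^'n \<Rightarrow> real" where
  "quad D w \<equiv> w \<bullet> (D *v w)"

lemma norm_add_scaleR_power2:
  "(norm (u + t *\<^sub>R w))\<^sup>2 = (norm u)\<^sup>2 + 2 * t * (u \<bullet> w) + t\<^sup>2 * (norm w)\<^sup>2"
  for u w :: "'a::real_inner"
  unfolding power2_norm_eq_inner
  by (simp only: inner_add_left inner_add_right inner_scaleR_left inner_scaleR_right inner_commute[of w u])
    (simp add: power2_eq_square algebra_simps)

lemma inner_transpose_mult: "(transpose A *v u) \<bullet> w = u \<bullet> (A *v w)" for A :: "real^'n^'m"
  by (metis dot_lmul_matrix transpose_matrix_vector)

text \<open>The simplifier would turn \<open>transpose A *v u\<close> into \<open>u v* A\<close>, on which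
  the adjoint rule above does not fire.\<close>

declare transpose_matrix_vector [simp del]

lemma inner_symmetric_mult:
  "transpose D = D \<Longrightarrow> u \<bullet> (D *v w) = w \<bullet> (D *v u)" for D :: "real^'n^'n"
  by (metis inner_transpose_mult inner_commute)

lemma pos_semidef_sym: "pos_semidef D \<Longrightarrow> transpose D = D"
  by (simp add: pos_semidef_def)

lemma quad_nonneg: "pos_semidef D \<Longrightarrow> 0 \<le> quad D w"
  by (simp add: pos_semidef_def)

lemma weighted_norm_power2: "pos_semidef D \<Longrightarrow> (weighted_norm D w)\<^sup>2 = quad D w"
  by (simp add: weighted_norm_def pos_semidef_def)

lemma quad_scaleR: "quad (c *\<^sub>R D) w = c * quad D w"
  by (simp add: scaleR_matrix_vector_assoc[symmetric])

lemma quad_gram: "quad (transpose A ** A) w = (norm (A *v w))\<^sup>2" for A :: "real^'n^'m"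
  unfolding matrix_vector_mul_assoc[symmetric] power2_norm_eq_inner inner_commute[of w]
  by (rule inner_transpose_mult)

lemma loewner_leD: "loewner_le D E \<Longrightarrow> quad D w \<le> quad E w"
  by (auto simp: loewner_le_def pos_semidef_def matrix_vector_mult_diff_rdistrib inner_diff_right)

lemma pos_semidef_scaleR: "0 \<le> c \<Longrightarrow> pos_semidef D \<Longrightarrow> pos_semidef (c *\<^sub>R D)"
  by (simp add: pos_semidef_def transpose_scalar quad_scaleR)

lemma quad_add:
  assumes "transpose D = D"
  shows "quad D (u + w) = quad D u + 2 * (u \<bullet> (D *v w)) + quad D w"
  using inner_symmetric_mult[OF assms, of u w]
  by (simp add: matrix_vector_right_distrib inner_add_left inner_add_right)

text \<open>This turns the inner product of a step \<open>u\<close> with the new error \<open>w\<close> into the difference of the squared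
  new and old errors \<open>w\<close> and \<open>w - u\<close>, plus the square of the step; it is what makes
  the energy below telescope.\<close>

lemma three_point_identity:
  assumes "transpose D = D"
  shows "2 * ((D *v u) \<bullet> w) = quad D w - quad D (w - u) + quad D u"
  using quad_add[OF assms, of "w - u" u] inner_symmetric_mult[OF assms, of w u]
  by (simp add: inner_diff_left inner_commute[of "D *v u"])

lemma quad_young:
  assumes "pos_semidef D"
  shows "2 * (p * q * ((D *v u) \<bullet> w)) \<le> p\<^sup>2 * quad D w + q\<^sup>2 * quad D u"
proof -
  have "0 \<le> quad D (p *\<^sub>R w + (- q) *\<^sub>R u)"
    by (rule quad_nonneg[OF assms])
  also have "\<dots> = p\<^sup>2 * quad D w - 2 * (p * q * ((D *v u) \<bullet> w)) + q\<^sup>2 * quad D u"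
    unfolding quad_add[OF pos_semidef_sym[OF assms]]
    unfolding matrix_vector_mult_scaleR inner_scaleR_left inner_scaleR_right
      inner_symmetric_mult[OF pos_semidef_sym[OF assms], of w u] inner_commute[of "D *v u" w]
    by (simp add: power2_eq_square inner_symmetric_mult[OF pos_semidef_sym[OF assms], of u w])
  finally show ?thesis by simp
qed

text \<open>Cauchy--Schwarz for the form of \<open>D\<close>, applied to \<open>w\<close> and \<open>D w\<close>. It lets \<open>D w\<^sub>k \<longlonglongrightarrow> 0\<close> be read off from
  \<open>\<parallel>w\<^sub>k\<parallel>\<^sub>D \<longlonglongrightarrow> 0\<close>, even when \<open>D\<close> is singular and \<open>w\<^sub>k\<close> itself stays away from zero.\<close>

lemma norm_pos_semidef_mult_bound:
  assumes D: "pos_semidef D" and K: "\<And>u. quad D u \<le> K * (norm u)\<^sup>2"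
  shows "(norm (D *v w))\<^sup>2 \<le> K * quad D w"
proof (cases "K > 0")
  case True
  have "2 * (1 * K * ((D *v w) \<bullet> (D *v w))) \<le> 1\<^sup>2 * quad D (D *v w) + K\<^sup>2 * quad D w"
    by (rule quad_young[OF D])
  with K[of "D *v w"] have "K * (norm (D *v w))\<^sup>2 \<le> K * (K * quad D w)"
    unfolding power2_norm_eq_inner by (simp add: power2_eq_square)
  with True show ?thesis by simp
next
  case False
  have "quad D u = 0" for u
    using K[of u] quad_nonneg[OF D, of u] False
    by (smt (verit) mult_nonpos_nonneg zero_le_power2)
  with quad_young[OF D, of 1 1 w "D *v w"] show ?thesis
    by (simp add: power2_norm_eq_inner)
qed

lemma quad_bounded: "\<exists>K\<ge>0. \<forall>u. quad D u \<le> K * (norm u)\<^sup>2" for D :: "real^'n^'n"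
proof -
  obtain K where K: "K > 0" "\<And>u. norm (D *v u) \<le> norm u * K"
    using bounded_linear.pos_bounded[OF matrix_vector_mul_bounded_linear[of D]] by blast
  have "quad D u \<le> K * (norm u)\<^sup>2" for u
  proof -
    have "quad D u \<le> norm u * norm (D *v u)" by (rule norm_cauchy_schwarz)
    also have "\<dots> \<le> norm u * (norm u * K)" by (intro mult_left_mono K) simp
    finally show ?thesis by (simp add: power2_eq_square mult_ac)
  qed
  with K show ?thesis by (intro exI[of _ K]) auto
qed

lemma continuous_quad: "continuous_on S (quad D)" for D :: "real^'n^'n"
  by (intro continuous_intros linear_continuous_on matrix_vector_mul_bounded_linear)

lemma tendsto_quad: "(w \<longlongrightarrow> v) F \<Longrightarrow> ((\<lambda>x. quad D (w x)) \<longlongrightarrow> quad D v) F"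
  for D :: "real^'n^'n"
  by (intro tendsto_intros bounded_linear.tendsto[OF matrix_vector_mul_bounded_linear])

lemma quad_unit_vector: "quad D w = (norm w)\<^sup>2 * quad D (w /\<^sub>R norm w)" for w :: "real^'n"
  by (cases "w = 0") (simp_all add: matrix_vector_mult_scaleR power2_eq_square divide_simps)

lemma pos_def_coercive:
  fixes T :: "real^'n^'n"
  assumes "pos_def T"
  shows "\<exists>c>0. \<forall>w. c * (norm w)\<^sup>2 \<le> quad T w"
proof -
  obtain v :: "real^'n" where v: "norm v = 1" "\<And>w. norm w = 1 \<Longrightarrow> quad T v \<le> quad T w"
    using continuous_attains_inf[OF compact_sphere[of 0 1] _ continuous_quad[of _ T]] by auto
  have "quad T v > 0" using assms v(1) unfolding pos_def_def by (metis norm_zero zero_neq_one)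
  moreover have "quad T v * (norm w)\<^sup>2 \<le> quad T w" for w
  proof (cases "w = 0")
    case False
    then show ?thesis
      using v(2)[of "w /\<^sub>R norm w"] by (subst quad_unit_vector) (simp add: mult.commute mult_left_mono)
  qed simp
  ultimately show ?thesis by blast
qed

text \<open>Eigenvectors for distinct eigenvalues are orthogonal, hence independent, and there are only
  finitely many independent vectors.\<close>

lemma finite_eigenvalues:
  assumes "transpose D = D"
  shows "finite (eigenvalues D)"
proof -
  have "\<forall>c\<in>eigenvalues D. \<exists>v. v \<noteq> 0 \<and> D *v v = c *\<^sub>R v"
    by (simp add: eigenvalues_def)
  from bchoice[OF this] obtain v
    where v: "\<And>c. c \<in> eigenvalues D \<Longrightarrow> v c \<noteq> 0 \<and> D *v v c = c *\<^sub>R v c"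
    by blast
  have orth: "v c \<bullet> v d = 0" if "c \<in> eigenvalues D" "d \<in> eigenvalues D" "c \<noteq> d" for c d
    using inner_symmetric_mult[OF assms, of "v c" "v d"] v[OF that(1)] v[OF that(2)] that(3)
    by (simp add: inner_commute)
  have "inj_on v (eigenvalues D)"
    by (rule inj_onI) (metis inner_eq_zero_iff orth v)
  moreover have "independent (v ` eigenvalues D)"
    using orth v
    by (intro pairwise_orthogonal_independent) (fastforce simp: pairwise_def orthogonal_def)+
  ultimately show ?thesis
    using finite_imageD independent_bound by blast
qed

text \<open>The Rayleigh quotient attains its maximum on the unit sphere, and its maximum value is an
  eigenvalue.\<close>

lemma quad_le_lambda_max:
  assumes "transpose D = D"
  shows "quad D w \<le> lambda_max D * (norm w)\<^sup>2"
proof -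
  obtain v where v: "norm v = 1" "\<And>w. norm w = 1 \<Longrightarrow> quad D w \<le> quad D v"
    using continuous_attains_sup[OF compact_sphere[of 0 1] _ continuous_quad[of _ D]] by auto
  define m where "m = quad D v"
  have le: "quad D w \<le> m * (norm w)\<^sup>2" for w
  proof (cases "w = 0")
    case False
    then show ?thesis
      using v(2)[of "w /\<^sub>R norm w"] unfolding m_def
      by (subst quad_unit_vector) (simp add: mult.commute mult_left_mono)
  qed simp
  \<comment> \<open>\<open>m I - D\<close> is positive semidefinite and its form vanishes at \<open>v\<close>, so it annihilates \<open>v\<close>.\<close>
  define M where "M = m *\<^sub>R mat 1 - D"
  have M: "M *v u = m *\<^sub>R u - D *v u" for u
    by (simp add: M_def matrix_vector_mult_diff_rdistrib scaleR_matrix_vector_assoc[symmetric])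
  have "transpose M = M"
    using assms by (simp add: M_def transpose_def vec_eq_iff mat_def)
  then have "pos_semidef M"
    using le by (simp add: pos_semidef_def M inner_diff_right power2_norm_eq_inner)
  moreover have "quad M v = 0"
    using v(1) by (simp add: M inner_diff_right m_def norm_eq_1)
  ultimately have "M *v v = 0"
    using norm_pos_semidef_mult_bound[of M _ v] quad_bounded[of M] by fastforce
  then have "m \<in> eigenvalues D"
    using v(1) by (auto simp: M eigenvalues_def intro!: exI[of _ v])
  then have "m \<le> lambda_max D"
    unfolding lambda_max_def by (intro Max_ge finite_eigenvalues assms)
  with le show ?thesis by (meson mult_right_mono order_trans zero_le_power2)
qed

section \<open>Subgradients\<close>

lemma subdiff_finite:
  assumes "proper_fun f" "\<xi> \<in> subdiff f x"
  obtains r where "f x = ereal r"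
proof -
  obtain w where "f w \<noteq> \<infinity>" using assms(1) by (auto simp: proper_fun_def)
  moreover have "f w \<ge> f x + ereal (\<xi> \<bullet> (w - x))" using assms(2) by (auto simp: subdiff_def)
  ultimately have "f x \<noteq> \<infinity>" by auto
  moreover have "f x \<noteq> -\<infinity>" using assms(1) by (auto simp: proper_fun_def)
  ultimately show ?thesis using that by (cases "f x") auto
qed

lemma subdiff_monotone:
  assumes f: "proper_fun f" and "\<xi> \<in> subdiff f x" "\<eta> \<in> subdiff f w"
  shows "0 \<le> (\<xi> - \<eta>) \<bullet> (x - w)"
proof -
  obtain r q where r: "f x = ereal r" "f w = ereal q"
    using subdiff_finite[OF f] assms(2,3) by metis
  have "f w \<ge> f x + ereal (\<xi> \<bullet> (w - x))" "f x \<ge> f w + ereal (\<eta> \<bullet> (x - w))"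
    using assms(2,3) by (auto simp: subdiff_def)
  then show ?thesis by (simp add: r inner_diff_left inner_diff_right)
qed

lemma subdiff_strongly_monotone:
  assumes f: "proper_fun f" and s: "strongly_convex_fun \<sigma> f"
    and "\<xi> \<in> subdiff f x" "\<eta> \<in> subdiff f w"
  shows "\<sigma> * (norm (x - w))\<^sup>2 \<le> (\<xi> - \<eta>) \<bullet> (x - w)"
proof -
  obtain r q where r: "f x = ereal r" "f w = ereal q"
    using subdiff_finite[OF f] assms(3,4) by metis
  have "f w - f x \<ge> ereal (\<xi> \<bullet> (w - x) + \<sigma> / 2 * (norm (w - x))\<^sup>2)"
    "f x - f w \<ge> ereal (\<eta> \<bullet> (x - w) + \<sigma> / 2 * (norm (x - w))\<^sup>2)"
    using s assms(3,4) by (auto simp: strongly_convex_fun_def)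
  then show ?thesis
    by (simp add: r inner_diff_left inner_diff_right norm_minus_commute[of w])
qed

text \<open>Since \<open>at x\<close> excludes \<open>x\<close>, the point itself is added back here; sequences tending to \<open>x\<close> may
  hit it.\<close>

lemma lsc_fun_eventually:
  assumes "lsc_fun f" "c < f x"
  shows "eventually (\<lambda>w. c < f w) (nhds x)"
proof -
  have "eventually (\<lambda>w. c < f w) (at x)"
    using assms le_Liminf_iff[of "f x" "at x" f] by (auto simp: lsc_fun_def)
  with assms(2) show ?thesis
    by (simp add: eventually_nhds_conv_at)
qed

text \<open>Every subgradient inequality passes to the limit: lower semicontinuity takes care of
  \<open>f (x n)\<close>, and the other terms are continuous.\<close>

lemma subdiff_closed_graph:
  fixes x :: "nat \<Rightarrow> 'a::real_inner"
  assumes f: "lsc_fun f" and x: "x \<longlonglongrightarrow> x'" and \<xi>: "\<xi> \<longlonglongrightarrow> \<xi>'"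
    and sub: "\<And>n. \<xi> n \<in> subdiff f (x n)"
  shows "\<xi>' \<in> subdiff f x'"
  unfolding subdiff_def
proof (intro CollectI allI)
  fix w
  have le: "f (x n) + ereal (\<xi> n \<bullet> (w - x n)) \<le> f w" for n
    using sub[of n] by (auto simp: subdiff_def)
  have lim: "(\<lambda>n. ereal (\<xi> n \<bullet> (w - x n))) \<longlonglongrightarrow> ereal (\<xi>' \<bullet> (w - x'))"
    using x \<xi> by (intro tendsto_intros)
  have "f x' \<le> f w - ereal (\<xi>' \<bullet> (w - x'))"
  proof (rule dense_le)
    fix c assume "c < f x'"
    then have "eventually (\<lambda>n. c < f (x n)) sequentially"
      using lsc_fun_eventually[OF f] x by (auto simp: tendsto_def filterlim_def le_filter_def eventually_filtermap)
    then have "eventually (\<lambda>n. c \<le> f w - ereal (\<xi> n \<bullet> (w - x n))) sequentially"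
    proof eventually_elim
      case (elim n)
      then show ?case
        using le[of n] by (simp add: ereal_le_minus) (meson add_right_mono less_imp_le order_trans)
    qed
    moreover have "(\<lambda>n. f w - ereal (\<xi> n \<bullet> (w - x n))) \<longlonglongrightarrow> f w - ereal (\<xi>' \<bullet> (w - x'))"
      by (intro tendsto_diff_ereal_general tendsto_const lim) auto
    ultimately show "c \<le> f w - ereal (\<xi>' \<bullet> (w - x'))"
      by (intro tendsto_lowerbound[of _ _ sequentially]) auto
  qed
  then show "f x' + ereal (\<xi>' \<bullet> (w - x')) \<le> f w"
    by (simp add: ereal_le_minus)
qed

text \<open>Fermat's rule for the sum of a convex function and a smooth one, by differentiating along the
  segment from \<open>x\<close> to \<open>w\<close>: convexity bounds the change of \<open>f\<close> linearly, and the quadratic part of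
  \<open>h\<close> vanishes to second order. The vector \<open>q\<close> is the gradient of \<open>h\<close> at \<open>x\<close>.\<close>

lemma subgradient_of_minimizer:
  assumes f: "proper_fun f" "convex_fun f"
    and min: "is_arg_min (\<lambda>w. f w + ereal (h w)) (\<lambda>_. True) x"
    and h: "\<And>t d. h (x + t *\<^sub>R d) = h x + t * (q \<bullet> d) + t\<^sup>2 * c d"
  shows "- q \<in> subdiff f x"
  unfolding subdiff_def
proof (intro CollectI allI)
  fix w
  have le: "f x + ereal (h x) \<le> f v + ereal (h v)" for v
    using min by (auto simp: is_arg_min_def not_less)
  obtain v where "f v \<noteq> \<infinity>" using f(1) by (auto simp: proper_fun_def)
  then have "f x \<noteq> \<infinity>" using le[of v] by auto
  then obtain r where r: "f x = ereal r"
    using f(1) by (cases "f x") (auto simp: proper_fun_def)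
  show "f x + ereal (- q \<bullet> (w - x)) \<le> f w"
  proof (cases "f w")
    case (real p)
    define d where "d = w - x"
    have "r - p - q \<bullet> d \<le> t * c d" if t: "0 < t" "t < 1" for t
    proof -
      have eq: "(1 - t) *\<^sub>R x + t *\<^sub>R w = x + t *\<^sub>R d" by (simp add: d_def algebra_simps)
      have "ereal r + ereal (h x) \<le> f (x + t *\<^sub>R d) + ereal (h (x + t *\<^sub>R d))"
        using le r by simp
      also have "f (x + t *\<^sub>R d) \<le> ereal (1 - t) * f x + ereal t * f w"
        using f(2) t unfolding convex_fun_def eq[symmetric] by blast
      finally have "r + h x \<le> (1 - t) * r + t * p + (h x + t * (q \<bullet> d) + t\<^sup>2 * c d)"
        by (simp add: r real h add_right_mono)
      then have "t * (r - p - q \<bullet> d) \<le> t * (t * c d)"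
        by (simp add: algebra_simps power2_eq_square)
      with t show ?thesis by simp
    qed
    then have "eventually (\<lambda>t. r - p - q \<bullet> d \<le> t * c d) (at_right 0)"
      using eventually_at_right_real[of 0 1] by (auto elim!: eventually_mono)
    moreover have "((\<lambda>t. t * c d) \<longlongrightarrow> 0 * c d) (at_right 0)"
      by (intro tendsto_intros)
    ultimately have "r - p - q \<bullet> d \<le> 0 * c d"
      by (intro tendsto_lowerbound[of _ _ "at_right 0"]) auto
    then show ?thesis by (simp add: r real d_def)
  qed (use f(1) in \<open>auto simp: proper_fun_def\<close>)
qed

text \<open>Both subproblems of the algorithm have this form, with \<open>A = B\<close>, \<open>a = C z\<^sup>k - b\<close> for the first and
  \<open>A = C\<close>, \<open>a = B y\<^sup>k\<^sup>+\<^sup>1 - b\<close> for the second.\<close>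

lemma augmented_lagrangian_minimizer:
  fixes A :: "real^'n^'m" and \<phi> :: "real^'n \<Rightarrow> ereal"
  assumes \<phi>: "proper_fun \<phi>" "convex_fun \<phi>" and P: "pos_semidef P"
    and min: "is_arg_min (\<lambda>w. \<phi> w + ereal (u \<bullet> (A *v w) + \<beta> / 2 * (norm (A *v w + a))\<^sup>2
                + 1 / 2 * (weighted_norm P (w - w0))\<^sup>2)) (\<lambda>_. True) x"
  shows "- (transpose A *v (u + \<beta> *\<^sub>R (A *v x + a)) + P *v (x - w0)) \<in> subdiff \<phi> x"
proof (rule subgradient_of_minimizer[OF \<phi> min])
  fix t d
  let ?c = "\<beta> / 2 * (norm (A *v d))\<^sup>2 + 1 / 2 * quad P d"
  have 1: "A *v (x + t *\<^sub>R d) + a = (A *v x + a) + t *\<^sub>R (A *v d)"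
    by (simp add: matrix_vector_right_distrib matrix_vector_mult_scaleR)
  have "quad P (x + t *\<^sub>R d - w0) = quad P ((x - w0) + t *\<^sub>R d)"
    by (simp add: algebra_simps)
  also have "\<dots> = quad P (x - w0) + 2 * t * (d \<bullet> (P *v (x - w0))) + t\<^sup>2 * quad P d"
    unfolding quad_add[OF pos_semidef_sym[OF P]] inner_symmetric_mult[OF pos_semidef_sym[OF P], of "x - w0" "t *\<^sub>R d"]
    by (simp add: matrix_vector_mult_scaleR power2_eq_square)
  finally have 2: "quad P (x + t *\<^sub>R d - w0) = \<dots>" .
  have 3: "(norm (A *v x + a + t *\<^sub>R (A *v d)))\<^sup>2 =
      (norm (A *v x + a))\<^sup>2 + 2 * t * ((A *v x + a) \<bullet> (A *v d)) + t\<^sup>2 * (norm (A *v d))\<^sup>2"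
    by (rule norm_add_scaleR_power2)
  show "u \<bullet> (A *v (x + t *\<^sub>R d)) + \<beta> / 2 * (norm (A *v (x + t *\<^sub>R d) + a))\<^sup>2
          + 1 / 2 * (weighted_norm P (x + t *\<^sub>R d - w0))\<^sup>2
      = u \<bullet> (A *v x) + \<beta> / 2 * (norm (A *v x + a))\<^sup>2 + 1 / 2 * (weighted_norm P (x - w0))\<^sup>2
        + t * ((transpose A *v (u + \<beta> *\<^sub>R (A *v x + a)) + P *v (x - w0)) \<bullet> d) + t\<^sup>2 * ?c"
    unfolding weighted_norm_power2[OF P] 1 2 3 inner_add_left[of _ _ d] inner_transpose_mult
    by (simp add: matrix_vector_right_distrib matrix_vector_mult_scaleR inner_add_left inner_add_right
        inner_commute algebra_simps add_divide_distrib)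
qed

lemma zero_in_translate_iff: "0 \<in> (\<lambda>\<xi>. \<xi> + v) ` S \<longleftrightarrow> - v \<in> S" for v :: "'a::ab_group_add"
  unfolding image_iff by (metis add.commute add.right_inverse minus_unique)

lemma kkt_solution_iff:
  "kkt_solution f g B C b (ys, zs, ls) \<longleftrightarrow>
     - (transpose B *v ls) \<in> subdiff f ys \<and> - (transpose C *v ls) \<in> subdiff g zs \<and>
     B *v ys + C *v zs = b"
  by (simp add: kkt_solution_def zero_in_translate_iff)

section \<open>Sequences\<close>

lemma summable_energy_decrease:
  fixes E e :: "nat \<Rightarrow> real"
  assumes "\<And>n. E (Suc n) + e n \<le> E n" "\<And>n. 0 \<le> E n" "\<And>n. 0 \<le> e n"
  shows "summable e"
proof (rule summableI_nonneg_bounded)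
  fix n
  have "(\<Sum>i<n. e i) + E n \<le> E 0"
  proof (induction n)
    case (Suc n)
    then show ?case using assms(1)[of n] by simp
  qed simp
  then show "(\<Sum>i<n. e i) \<le> E 0" using assms(2)[of n] by simp
qed (use assms in auto)

text \<open>Otherwise \<open>a n \<ge> \<delta> / \<beta> n\<close> from some point on, and the right-hand side is not summable because it
  dominates a multiple of the harmonic series.\<close>

lemma frequently_small_if_linear_growth:
  fixes a \<beta> :: "nat \<Rightarrow> real"
  assumes "summable a" "\<And>n. 0 < \<beta> n" "\<And>n. \<beta> n \<le> M * real (Suc n)" "\<delta> > 0"
  shows "\<exists>n\<ge>N. \<beta> n * a n < \<delta>"
proof (rule ccontr)
  assume "\<not> ?thesis"
  then have ge: "\<delta> \<le> \<beta> n * a n" if "n \<ge> N" for n using that by (meson not_less)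
  have M: "M > 0" using assms(2,3)[of 0] by simp
  have "norm (inverse (of_nat (Suc n)) :: real) \<le> (M / \<delta>) * a n" if "n \<ge> N" for n
  proof -
    have an: "0 < a n"
      using ge[OF that] assms(2)[of n] assms(4) by (smt (verit) zero_less_mult_pos)
    have "\<delta> \<le> M * real (Suc n) * a n"
      using ge[OF that] mult_right_mono[OF assms(3)[of n] less_imp_le[OF an]] by linarith
    then show ?thesis using assms(4) by (simp add: field_simps)
  qed
  then have "summable (\<lambda>n. inverse (of_nat (Suc n)) :: real)"
    by (intro summable_comparison_test'[OF summable_mult[OF assms(1), of "M / \<delta>"]])
  then show False
    using not_summable_harmonic[where 'a = real] by (simp only: summable_Suc_iff[where f = "\<lambda>n. inverse (of_nat n)"])
qed

lemma tendsto_zero_if_norm_power2: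
  fixes x :: "nat \<Rightarrow> 'a::real_normed_vector"
  assumes "(\<lambda>n. (norm (x n))\<^sup>2) \<longlonglongrightarrow> 0"
  shows "x \<longlonglongrightarrow> 0"
  using tendsto_real_sqrt[OF assms] by (simp add: tendsto_norm_zero_iff)

lemma tendsto_zero_if_scaled:
  fixes x :: "nat \<Rightarrow> 'a::real_normed_vector"
  assumes "(\<lambda>n. c n *\<^sub>R x n) \<longlonglongrightarrow> 0" "0 < m" "\<And>n. m \<le> c n"
  shows "x \<longlonglongrightarrow> 0"
proof (rule Lim_null_comparison)
  have "m * norm (x n) \<le> norm (c n *\<^sub>R x n)" for n
    using assms(2) assms(3)[of n] by (simp add: mult_right_mono)
  then show "eventually (\<lambda>n. norm (x n) \<le> norm (c n *\<^sub>R x n) / m) sequentially"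
    using assms(2) by (simp add: field_simps)
  show "(\<lambda>n. norm (c n *\<^sub>R x n) / m) \<longlonglongrightarrow> 0"
    using tendsto_divide[OF tendsto_norm_zero[OF assms(1)] tendsto_const[of m]] assms(2) by simp
qed

section \<open>The energy inequality\<close>

text \<open>The sequences start at index 0 here, which is index 1 in the algorithm. The auxiliary
  number \<open>s\<close> is the weight in the Young inequality of the cross-term estimate. It must exceed \<open>\<gamma> - 1\<close>
  so that \<open>\<parallel>C (z\<^sup>k\<^sup>+\<^sup>1 - z\<^sup>k)\<parallel>\<^sup>2\<close> is absorbed, and satisfy \<open>(\<gamma> - 1) s < 2 - \<gamma>\<close> so that the squared residual
  is absorbed; both are possible exactly when \<open>(\<gamma> - 1)\<^sup>2 < 2 - \<gamma>\<close>, which for \<open>\<gamma> > 1\<close> means that \<open>\<gamma>\<close> is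
  below the golden ratio.\<close>

locale iadmm_iteration =
  fixes f :: "real^'p \<Rightarrow> ereal" and g :: "real^'q \<Rightarrow> ereal"
    and B :: "real^'p^'m" and C :: "real^'q^'m" and b :: "real^'m"
    and \<sigma> \<gamma> \<epsilon> \<beta>low s :: real
    and Q :: "real^'q^'q" and P :: "nat \<Rightarrow> real^'p^'p" and \<Theta> :: "real^'p^'p" and \<beta> :: "nat \<Rightarrow> real"
    and y :: "nat \<Rightarrow> real^'p" and z :: "nat \<Rightarrow> real^'q" and l :: "nat \<Rightarrow> real^'m"
  assumes f: "proper_fun f" "lsc_fun f" "convex_fun f"
    and g: "proper_fun g" "lsc_fun g" "convex_fun g" "strongly_convex_fun \<sigma> g"
    and \<sigma>: "0 < \<sigma>"
    and \<gamma>: "1 < \<gamma>"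
    and s: "\<gamma> - 1 < s" "(\<gamma> - 1) * s < 2 - \<gamma>"
    and \<epsilon>: "0 < \<epsilon>" "\<epsilon> < 1"
    and \<beta>low: "0 < \<beta>low" "\<And>k. \<beta>low \<le> \<beta> k"
    and Q: "pos_semidef Q"
    and P: "\<And>k. pos_semidef (P k)"
    and P_decreasing: "\<And>k. loewner_le (\<beta> (Suc k) *\<^sub>R P (Suc k)) (\<beta> k *\<^sub>R P k)"
    and lambda_max_pos: "0 < lambda_max (transpose C ** C + Q)"
    and y_step: "\<And>k. is_arg_min (iadmm_y_objective f B C b (\<beta> k) (P k) (y k) (z k) (l k))
                   (\<lambda>_. True) (y (Suc k))"
    and z_step: "\<And>k. is_arg_min (iadmm_z_objective g B C b (\<beta> k) (\<beta> k *\<^sub>R Q) (y (Suc k)) (z k) (l k))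
                   (\<lambda>_. True) (z (Suc k))"
    and l_step: "\<And>k. l (Suc k) = l k + (\<gamma> * \<beta> k) *\<^sub>R (B *v y (Suc k) + C *v z (Suc k) - b)"
    and \<beta>_step: "\<And>k. \<beta> (Suc k) \<le> sqrt ((\<beta> k)\<^sup>2 + (1 - \<epsilon>) * \<sigma> * \<beta> k
                                        / lambda_max (transpose C ** C + Q))"
    and \<Theta>: "pos_def \<Theta>"
      "\<And>k. loewner_le \<Theta> (\<beta> k *\<^sub>R P k + (\<beta> k)\<^sup>2 *\<^sub>R (transpose B ** B))"
begin

definition D where "D = transpose C ** C + Q"

definition residual where "residual k = B *v y k + C *v z k - b"

definition dz where "dz k = z (Suc k) - z k"

lemma \<beta>_pos: "0 < \<beta> k"
  using \<beta>low(1) \<beta>low(2)[of k] by linarith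

lemma quad_D: "quad D w = (norm (C *v w))\<^sup>2 + quad Q w"
  by (simp add: D_def matrix_vector_mult_add_rdistrib inner_add_right quad_gram)

lemma D: "pos_semidef D"
proof -
  have "transpose D = D"
    using pos_semidef_sym[OF Q] unfolding D_def
    by (simp add: transpose_def vec_eq_iff matrix_matrix_mult_def mult.commute)
  then show ?thesis using quad_nonneg[OF Q] by (simp add: pos_semidef_def quad_D)
qed

lemma quad_D_le: "quad D w \<le> lambda_max D * (norm w)\<^sup>2"
  by (rule quad_le_lambda_max[OF pos_semidef_sym[OF D]])

lemma D_lambda_max_pos: "0 < lambda_max D"
  using lambda_max_pos by (simp add: D_def)

lemma l_residual: "l (Suc k) = l k + (\<gamma> * \<beta> k) *\<^sub>R residual (Suc k)"
  by (simp add: l_step residual_def)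

lemma y_subgradient:
  "- (transpose B *v (l k + \<beta> k *\<^sub>R (residual (Suc k) - C *v dz k)) + P k *v (y (Suc k) - y k))
     \<in> subdiff f (y (Suc k))"
proof -
  have "residual (Suc k) - C *v dz k = B *v y (Suc k) + (C *v z k - b)"
    by (simp add: residual_def dz_def matrix_vector_mult_diff_distrib)
  then show ?thesis
    using augmented_lagrangian_minimizer[OF f(1,3) P[of k], of "l k" B "\<beta> k" "C *v z k - b" "y k" "y (Suc k)"]
      y_step[of k]
    by (simp add: iadmm_y_objective_def[abs_def] add_diff_eq)
qed

lemma z_subgradient:
  "- (transpose C *v (l k + \<beta> k *\<^sub>R residual (Suc k)) + \<beta> k *\<^sub>R (Q *v dz k)) \<in> subdiff g (z (Suc k))"
proof -
  have eq: "B *v v + C *v w - b = C *v w + (B *v v - b)" for v w by simp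
  have "pos_semidef (\<beta> k *\<^sub>R Q)"
    using \<beta>_pos[of k] Q by (intro pos_semidef_scaleR) auto
  from augmented_lagrangian_minimizer[OF g(1,3) this, of "l k" C "\<beta> k" "B *v y (Suc k) - b" "z k" "z (Suc k)"]
  show ?thesis
    using z_step[of k]
    unfolding iadmm_z_objective_def[abs_def] residual_def dz_def eq scaleR_matrix_vector_assoc[symmetric]
    by blast
qed

text \<open>Add the monotonicity inequality of \<open>\<partial>f\<close> and the strong one of \<open>\<partial>g\<close> between the new iterate
  and the KKT point, multiply by \<open>2 \<beta> k\<close>, and rewrite the inner products of steps with errors by
  the three-point identity. One term has no sign, the product of \<open>C (z\<^sup>k\<^sup>+\<^sup>1 - z\<^sup>k)\<close> with the new residual.\<close>

lemma one_step_inequality: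
  assumes "kkt_solution f g B C b (ys, zs, ls)"
  shows "(norm (l (Suc k) - ls))\<^sup>2 / \<gamma> + \<beta> k * quad (P k) (y (Suc k) - ys)
       + (\<beta> k)\<^sup>2 * quad D (z (Suc k) - zs) + 2 * \<sigma> * \<beta> k * (norm (z (Suc k) - zs))\<^sup>2
       + (2 - \<gamma>) * (\<beta> k)\<^sup>2 * (norm (residual (Suc k)))\<^sup>2
       + \<beta> k * quad (P k) (y (Suc k) - y k) + (\<beta> k)\<^sup>2 * quad D (dz k)
    \<le> (norm (l k - ls))\<^sup>2 / \<gamma> + \<beta> k * quad (P k) (y k - ys) + (\<beta> k)\<^sup>2 * quad D (z k - zs)
       + 2 * (\<beta> k)\<^sup>2 * ((C *v dz k) \<bullet> residual (Suc k))"
proof -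
  note kkt = assms[unfolded kkt_solution_iff]
  define L r d w v h where "L = l k - ls" "r = residual (Suc k)" "d = dz k"
    "w = y (Suc k) - y k" "v = y (Suc k) - ys" "h = z (Suc k) - zs"
  note defs = this
  have Bv: "B *v v = r - C *v h"
    using kkt by (auto simp: defs residual_def matrix_vector_mult_diff_distrib)
  have "0 \<le> - ((L + \<beta> k *\<^sub>R (r - C *v d)) \<bullet> (B *v v)) - (P k *v w) \<bullet> v"
    using subdiff_monotone[OF f(1) y_subgradient[of k] conjunct1[OF kkt]] unfolding defs
    by (simp add: inner_diff_left inner_add_left inner_transpose_mult matrix_vector_right_distrib
        matrix_vector_mult_diff_distrib matrix_vector_mult_scaleR algebra_simps)
  moreover have "\<sigma> * (norm h)\<^sup>2 \<le> - ((L + \<beta> k *\<^sub>R r) \<bullet> (C *v h)) - \<beta> k * ((Q *v d) \<bullet> h)"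
    using subdiff_strongly_monotone[OF g(1,4) z_subgradient[of k] conjunct1[OF conjunct2[OF kkt]]]
    unfolding defs
    by (simp add: inner_diff_left inner_add_left inner_transpose_mult matrix_vector_right_distrib
        matrix_vector_mult_diff_distrib matrix_vector_mult_scaleR algebra_simps)
  moreover have "(D *v d) \<bullet> h = (C *v d) \<bullet> (C *v h) + (Q *v d) \<bullet> h"
    by (simp add: D_def matrix_vector_mult_add_rdistrib inner_add_left
        matrix_vector_mul_assoc[symmetric] inner_transpose_mult)
  ultimately have "\<sigma> * (norm h)\<^sup>2 + L \<bullet> r + \<beta> k * (norm r)\<^sup>2 - \<beta> k * ((C *v d) \<bullet> r)
      + (P k *v w) \<bullet> v + \<beta> k * ((D *v d) \<bullet> h) \<le> 0"
    unfolding Bv by (simp add: inner_diff_left inner_diff_right inner_add_left power2_norm_eq_inner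
        algebra_simps)
  then have "2 * \<beta> k * (\<sigma> * (norm h)\<^sup>2 + L \<bullet> r + \<beta> k * (norm r)\<^sup>2 - \<beta> k * ((C *v d) \<bullet> r)
      + (P k *v w) \<bullet> v + \<beta> k * ((D *v d) \<bullet> h)) \<le> 0"
    using \<beta>_pos[of k] by (simp add: mult_nonneg_nonpos)
  moreover have "(norm (l (Suc k) - ls))\<^sup>2 / \<gamma>
      = (norm L)\<^sup>2 / \<gamma> + 2 * \<beta> k * (L \<bullet> r) + \<gamma> * (\<beta> k)\<^sup>2 * (norm r)\<^sup>2"
  proof -
    have "l (Suc k) - ls = L + (\<gamma> * \<beta> k) *\<^sub>R r" by (simp add: l_residual defs)
    then have "(norm (l (Suc k) - ls))\<^sup>2
        = (norm L)\<^sup>2 + 2 * (\<gamma> * \<beta> k) * (L \<bullet> r) + (\<gamma> * \<beta> k)\<^sup>2 * (norm r)\<^sup>2"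
      by (simp only: norm_add_scaleR_power2)
    then show ?thesis using \<gamma> by (simp add: field_simps power2_eq_square)
  qed
  moreover have "2 * ((P k *v w) \<bullet> v) = quad (P k) v - quad (P k) (y k - ys) + quad (P k) w"
    using three_point_identity[OF pos_semidef_sym[OF P[of k]], of w v] by (simp add: defs)
  then have "2 * \<beta> k * ((P k *v w) \<bullet> v) = \<beta> k * (quad (P k) v - quad (P k) (y k - ys) + quad (P k) w)"
    by simp
  moreover have "2 * ((D *v d) \<bullet> h) = quad D h - quad D (z k - zs) + quad D d"
    using three_point_identity[OF pos_semidef_sym[OF D], of d h] by (simp add: defs dz_def)
  then have "2 * (\<beta> k)\<^sup>2 * ((D *v d) \<bullet> h) = (\<beta> k)\<^sup>2 * (quad D h - quad D (z k - zs) + quad D d)"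
    by simp
  ultimately show ?thesis
    unfolding defs(1)[symmetric] defs(2)[symmetric] defs(3)[symmetric] defs(4)[symmetric]
      defs(5)[symmetric] defs(6)[symmetric]
    by (simp add: algebra_simps power2_eq_square)
qed

text \<open>The cross term is estimated without the KKT point: two consecutive optimality conditions
  for \<open>z\<close> and monotonicity of \<open>\<partial>g\<close> trade the new residual for \<open>-(\<gamma> - 1)\<close> times the previous one, at the cost
  of terms in \<open>Q\<close>. Young's inequality then leaves only squares, of which those with index \<open>k\<close> can be carried
  in the energy.\<close>

lemma cross_term_bound:
  "2 * (\<beta> (Suc k))\<^sup>2 * ((C *v dz (Suc k)) \<bullet> residual (Suc (Suc k)))
     \<le> (\<gamma> - 1) * s * (\<beta> k)\<^sup>2 * (norm (residual (Suc k)))\<^sup>2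
       + (\<gamma> - 1) / s * (\<beta> (Suc k))\<^sup>2 * (norm (C *v dz (Suc k)))\<^sup>2
       + (\<beta> k)\<^sup>2 * quad Q (dz k) - (\<beta> (Suc k))\<^sup>2 * quad Q (dz (Suc k))"
proof -
  define p q r r' d d' where "p = \<beta> k" "q = \<beta> (Suc k)" "r = residual (Suc k)"
    "r' = residual (Suc (Suc k))" "d = dz k" "d' = dz (Suc k)"
  note defs = this
  have q: "0 < q" using \<beta>_pos by (simp add: defs)
  have s0: "0 < s" using s(1) \<gamma> by simp
  \<comment> \<open>The multiplier of the earlier condition is \<open>l k + p r\<close>, that of the later one
    \<open>l k + \<gamma> p r + q r'\<close>; their difference is \<open>q r' + (\<gamma> - 1) p r\<close>.\<close>
  have "0 \<le> - (q * (r' \<bullet> (C *v d'))) - (\<gamma> - 1) * p * (r \<bullet> (C *v d')) - q * ((Q *v d') \<bullet> d')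
      + p * ((Q *v d) \<bullet> d')"
    using subdiff_monotone[OF g(1) z_subgradient[of "Suc k"] z_subgradient[of k]]
    unfolding l_residual[of k] dz_def[of "Suc k", symmetric] defs[symmetric]
    by (simp add: inner_diff_left inner_add_left inner_transpose_mult matrix_vector_right_distrib
        matrix_vector_mult_diff_distrib matrix_vector_mult_scaleR algebra_simps)
  then have "0 \<le> 2 * q * (- (q * (r' \<bullet> (C *v d'))) - (\<gamma> - 1) * p * (r \<bullet> (C *v d')) - q * quad Q d'
      + p * ((Q *v d) \<bullet> d'))"
    using q by (simp add: inner_commute)
  then have "2 * q\<^sup>2 * ((C *v d') \<bullet> r') \<le> - (\<gamma> - 1) * (2 * p * q * (r \<bullet> (C *v d')))
      - 2 * q\<^sup>2 * quad Q d' + 2 * (q * p * ((Q *v d) \<bullet> d'))"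
    by (simp add: inner_commute[of "C *v d'"] algebra_simps power2_eq_square)
  moreover have "2 * (q * p * ((Q *v d) \<bullet> d')) \<le> q\<^sup>2 * quad Q d' + p\<^sup>2 * quad Q d"
    by (rule quad_young[OF Q])
  moreover have "- (\<gamma> - 1) * (2 * p * q * (r \<bullet> (C *v d')))
      \<le> (\<gamma> - 1) * (s * p\<^sup>2 * (norm r)\<^sup>2 + q\<^sup>2 * (norm (C *v d'))\<^sup>2 / s)"
  proof -
    \<comment> \<open>Young's inequality with weight \<open>s\<close>, divided by \<open>s\<close> so that \<open>p\<^sup>2 \<parallel>r\<parallel>\<^sup>2\<close> gets the factor \<open>s\<close>.\<close>
    have "0 \<le> (norm ((s * p) *\<^sub>R r + q *\<^sub>R (C *v d')))\<^sup>2" by simp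
    also have "\<dots> = s * (s * p\<^sup>2 * (norm r)\<^sup>2 + q\<^sup>2 * (norm (C *v d'))\<^sup>2 / s + 2 * p * q * (r \<bullet> (C *v d')))"
      unfolding norm_add_scaleR_power2
      using s0 by (simp add: power_mult_distrib power2_eq_square algebra_simps)
    finally have "0 \<le> s * p\<^sup>2 * (norm r)\<^sup>2 + q\<^sup>2 * (norm (C *v d'))\<^sup>2 / s + 2 * p * q * (r \<bullet> (C *v d'))"
      using s0 by (simp add: zero_le_mult_iff)
    from mult_left_mono[OF this, of "\<gamma> - 1"] \<gamma> show ?thesis by (simp add: algebra_simps)
  qed
  ultimately show ?thesis unfolding defs[symmetric] by (simp add: algebra_simps)
qed

text \<open>The Lyapunov function. The first three terms measure the distance to the KKT point; the weight
  \<open>\<beta>\<^sup>2\<close> of the third one grows with the penalty. The last two terms are the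
  index \<open>k\<close> part of the cross-term estimate.\<close>

definition energy where
  "energy ys zs ls k =
     (norm (l (Suc k) - ls))\<^sup>2 / \<gamma> + \<beta> (Suc k) * quad (P (Suc k)) (y (Suc k) - ys)
     + (\<beta> (Suc k))\<^sup>2 * quad D (z (Suc k) - zs)
     + (\<gamma> - 1) * s * (\<beta> k)\<^sup>2 * (norm (residual (Suc k)))\<^sup>2 + (\<beta> k)\<^sup>2 * quad Q (dz k)"

definition decrease where
  "decrease zs k =
     (2 - \<gamma> - (\<gamma> - 1) * s) * (\<beta> (Suc k))\<^sup>2 * (norm (residual (Suc (Suc k))))\<^sup>2
     + \<beta> (Suc k) * quad (P (Suc k)) (y (Suc (Suc k)) - y (Suc k))
     + (\<beta> (Suc k))\<^sup>2 * (quad Q (dz (Suc k)) + (1 - (\<gamma> - 1) / s) * (norm (C *v dz (Suc k)))\<^sup>2)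
     + \<sigma> * \<beta> (Suc k) * (norm (z (Suc (Suc k)) - zs))\<^sup>2"

lemma \<beta>_step_power2:
  "(\<beta> (Suc k))\<^sup>2 \<le> (\<beta> k)\<^sup>2 + (1 - \<epsilon>) * \<sigma> * \<beta> k / lambda_max D"
  using \<beta>_step[of k] \<beta>_pos[of "Suc k"] unfolding D_def
  by (metis less_imp_le real_le_rsqrt real_sqrt_le_iff real_sqrt_abs abs_of_pos real_sqrt_unique)

text \<open>The upper bound on the next penalty is designed for this: the increase of the weight in the
  energy is paid for by one half of the gain from strong convexity.\<close>

lemma \<beta>_growth: "(\<beta> (Suc k))\<^sup>2 * quad D w \<le> (\<beta> k)\<^sup>2 * quad D w + \<sigma> * \<beta> k * (norm w)\<^sup>2"
proof -
  have "(\<beta> (Suc k))\<^sup>2 * quad D w \<le> ((\<beta> k)\<^sup>2 + (1 - \<epsilon>) * \<sigma> * \<beta> k / lambda_max D) * quad D w"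
    by (intro mult_right_mono \<beta>_step_power2 quad_nonneg D)
  also have "\<dots> \<le> (\<beta> k)\<^sup>2 * quad D w + (1 - \<epsilon>) * \<sigma> * \<beta> k / lambda_max D * (lambda_max D * (norm w)\<^sup>2)"
    unfolding distrib_right using quad_D_le[of w] \<epsilon> \<sigma> \<beta>_pos[of k] D_lambda_max_pos
    by (intro add_left_mono mult_left_mono) auto
  also have "\<dots> = (\<beta> k)\<^sup>2 * quad D w + (1 - \<epsilon>) * (\<sigma> * \<beta> k * (norm w)\<^sup>2)"
    using D_lambda_max_pos by simp
  also have "\<dots> \<le> (\<beta> k)\<^sup>2 * quad D w + 1 * (\<sigma> * \<beta> k * (norm w)\<^sup>2)"
    using \<epsilon> \<sigma> \<beta>_pos[of k] by (intro add_left_mono mult_right_mono) auto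
  finally show ?thesis by simp
qed

lemma energy_nonneg: "0 \<le> energy ys zs ls k"
  using \<gamma> s \<beta>_pos[of "Suc k"] quad_nonneg[OF P] quad_nonneg[OF D] quad_nonneg[OF Q]
  unfolding energy_def by (intro add_nonneg_nonneg mult_nonneg_nonneg) (auto simp: less_imp_le)

lemma scaled_P_le_initial: "\<beta> k * quad (P k) w \<le> \<beta> 0 * quad (P 0) w"
proof (induction k)
  case (Suc k)
  then show ?case using loewner_leD[OF P_decreasing[of k], of w] by (simp add: quad_scaleR)
qed simp

text \<open>Of the gain \<open>2 \<sigma> \<beta> \<parallel>z - z\<^sup>*\<parallel>\<^sup>2\<close> in the one-step inequality, one half pays for the growth of \<open>\<beta>\<close> and
  the other half stays in \<open>decrease\<close>.\<close>

lemma energy_descent: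
  assumes "kkt_solution f g B C b (ys, zs, ls)"
  shows "energy ys zs ls (Suc k) + decrease zs k \<le> energy ys zs ls k"
proof -
  have "\<beta> (Suc (Suc k)) * quad (P (Suc (Suc k))) (y (Suc (Suc k)) - ys)
      \<le> \<beta> (Suc k) * quad (P (Suc k)) (y (Suc (Suc k)) - ys)"
    using loewner_leD[OF P_decreasing[of "Suc k"]] by (simp add: quad_scaleR)
  then show ?thesis
    using one_step_inequality[OF assms, of "Suc k"] cross_term_bound[of k]
      \<beta>_growth[of "Suc k" "z (Suc (Suc k)) - zs"]
    unfolding energy_def decrease_def quad_D[of "dz (Suc k)"]
    by (simp add: algebra_simps)
qed

section \<open>Consequences of the energy inequality\<close>

lemma decrease_parts:
  shows "(2 - \<gamma> - (\<gamma> - 1) * s) * ((\<beta> (Suc k))\<^sup>2 * (norm (residual (Suc (Suc k))))\<^sup>2) \<le> decrease zs k"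
    and "\<beta> (Suc k) * quad (P (Suc k)) (y (Suc (Suc k)) - y (Suc k)) \<le> decrease zs k"
    and "(\<beta> (Suc k))\<^sup>2 * quad Q (dz (Suc k)) \<le> decrease zs k"
    and "(1 - (\<gamma> - 1) / s) * ((\<beta> (Suc k))\<^sup>2 * (norm (C *v dz (Suc k)))\<^sup>2) \<le> decrease zs k"
    and "\<sigma> * (\<beta> (Suc k) * (norm (z (Suc (Suc k)) - zs))\<^sup>2) \<le> decrease zs k"
    and "0 \<le> decrease zs k"
proof -
  have "0 \<le> (2 - \<gamma> - (\<gamma> - 1) * s) * ((\<beta> (Suc k))\<^sup>2 * (norm (residual (Suc (Suc k))))\<^sup>2)"
    using s by simp
  moreover have "0 \<le> \<beta> (Suc k) * quad (P (Suc k)) (y (Suc (Suc k)) - y (Suc k))"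
    using \<beta>_pos[of "Suc k"] quad_nonneg[OF P] by simp
  moreover have "0 \<le> (\<beta> (Suc k))\<^sup>2 * quad Q (dz (Suc k))"
    using quad_nonneg[OF Q] by simp
  moreover have "0 \<le> 1 - (\<gamma> - 1) / s"
    using s \<gamma> by (simp add: field_simps)
  then have "0 \<le> (1 - (\<gamma> - 1) / s) * ((\<beta> (Suc k))\<^sup>2 * (norm (C *v dz (Suc k)))\<^sup>2)"
    by simp
  moreover have "0 \<le> \<sigma> * (\<beta> (Suc k) * (norm (z (Suc (Suc k)) - zs))\<^sup>2)"
    using \<beta>_pos[of "Suc k"] \<sigma> by simp
  moreover have "decrease zs k = (2 - \<gamma> - (\<gamma> - 1) * s) * ((\<beta> (Suc k))\<^sup>2 * (norm (residual (Suc (Suc k))))\<^sup>2)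
     + \<beta> (Suc k) * quad (P (Suc k)) (y (Suc (Suc k)) - y (Suc k))
     + (\<beta> (Suc k))\<^sup>2 * quad Q (dz (Suc k))
     + (1 - (\<gamma> - 1) / s) * ((\<beta> (Suc k))\<^sup>2 * (norm (C *v dz (Suc k)))\<^sup>2)
     + \<sigma> * (\<beta> (Suc k) * (norm (z (Suc (Suc k)) - zs))\<^sup>2)"
    by (simp add: decrease_def algebra_simps)
  ultimately show
    "(2 - \<gamma> - (\<gamma> - 1) * s) * ((\<beta> (Suc k))\<^sup>2 * (norm (residual (Suc (Suc k))))\<^sup>2) \<le> decrease zs k"
    "\<beta> (Suc k) * quad (P (Suc k)) (y (Suc (Suc k)) - y (Suc k)) \<le> decrease zs k"
    "(\<beta> (Suc k))\<^sup>2 * quad Q (dz (Suc k)) \<le> decrease zs k"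
    "(1 - (\<gamma> - 1) / s) * ((\<beta> (Suc k))\<^sup>2 * (norm (C *v dz (Suc k)))\<^sup>2) \<le> decrease zs k"
    "\<sigma> * (\<beta> (Suc k) * (norm (z (Suc (Suc k)) - zs))\<^sup>2) \<le> decrease zs k"
    "0 \<le> decrease zs k"
    by linarith+
qed

lemma summable_if_dominated_by_decrease:
  assumes kkt: "kkt_solution f g B C b (ys, zs, ls)"
    and "0 < c" "\<And>k. c * a (Suc k) \<le> decrease zs k" "\<And>k. 0 \<le> a k"
  shows "summable a"
proof -
  have "summable (decrease zs)"
    using energy_descent[OF kkt] energy_nonneg decrease_parts(6) by (rule summable_energy_decrease)
  then have "summable (\<lambda>k. decrease zs k / c)" by (rule summable_divide)
  then have "summable (\<lambda>k. a (Suc k))"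
  proof (rule summable_comparison_test')
    show "norm (a (Suc k)) \<le> decrease zs k / c" for k
      using assms(2) assms(3)[of k] assms(4)[of "Suc k"] by (simp add: field_simps)
  qed
  then show ?thesis by (simp only: summable_Suc_iff)
qed

lemma summable_parts:
  assumes kkt: "kkt_solution f g B C b (ys, zs, ls)"
  shows "summable (\<lambda>k. (\<beta> k)\<^sup>2 * (norm (residual (Suc k)))\<^sup>2)"
    and "summable (\<lambda>k. \<beta> k * quad (P k) (y (Suc k) - y k))"
    and "summable (\<lambda>k. (\<beta> k)\<^sup>2 * quad Q (dz k))"
    and "summable (\<lambda>k. (\<beta> k)\<^sup>2 * (norm (C *v dz k))\<^sup>2)"
    and "summable (\<lambda>k. \<beta> k * (norm (z (Suc k) - zs))\<^sup>2)"
proof -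
  have pos: "0 < 2 - \<gamma> - (\<gamma> - 1) * s" "0 < 1 - (\<gamma> - 1) / s"
    using s \<gamma> by (simp_all add: field_simps)
  note dominated = summable_if_dominated_by_decrease[OF kkt]
  show "summable (\<lambda>k. (\<beta> k)\<^sup>2 * (norm (residual (Suc k)))\<^sup>2)"
    by (rule dominated[OF pos(1) decrease_parts(1)]) simp
  show "summable (\<lambda>k. \<beta> k * quad (P k) (y (Suc k) - y k))"
    using decrease_parts(2) quad_nonneg[OF P] less_imp_le[OF \<beta>_pos] by (intro dominated[of 1]) auto
  show "summable (\<lambda>k. (\<beta> k)\<^sup>2 * quad Q (dz k))"
    using decrease_parts(3) quad_nonneg[OF Q] by (intro dominated[of 1]) auto
  show "summable (\<lambda>k. (\<beta> k)\<^sup>2 * (norm (C *v dz k))\<^sup>2)"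
    by (rule dominated[OF pos(2) decrease_parts(4)]) simp
  show "summable (\<lambda>k. \<beta> k * (norm (z (Suc k) - zs))\<^sup>2)"
    by (rule dominated[OF \<sigma> decrease_parts(5)]) (simp add: less_imp_le[OF \<beta>_pos])
qed

text \<open>Apart from \<open>z \<longlonglongrightarrow> zs\<close>, these are the quantities by which the optimality conditions of the subproblems deviate
  from the KKT conditions.\<close>

lemma tendsto_zero_parts:
  assumes kkt: "kkt_solution f g B C b (ys, zs, ls)"
  shows "(\<lambda>k. \<beta> k *\<^sub>R residual (Suc k)) \<longlonglongrightarrow> 0"
    and "(\<lambda>k. residual (Suc k)) \<longlonglongrightarrow> 0"
    and "(\<lambda>k. P k *v (y (Suc k) - y k)) \<longlonglongrightarrow> 0"
    and "(\<lambda>k. \<beta> k *\<^sub>R (Q *v dz k)) \<longlonglongrightarrow> 0"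
    and "(\<lambda>k. \<beta> k *\<^sub>R (C *v dz k)) \<longlonglongrightarrow> 0"
    and "z \<longlonglongrightarrow> zs"
proof -
  note lim = summable_parts[OF kkt, THEN summable_LIMSEQ_zero]
  show 1: "(\<lambda>k. \<beta> k *\<^sub>R residual (Suc k)) \<longlonglongrightarrow> 0"
    by (rule tendsto_zero_if_norm_power2) (use lim(1) in \<open>simp add: power_mult_distrib\<close>)
  show "(\<lambda>k. residual (Suc k)) \<longlonglongrightarrow> 0"
    by (rule tendsto_zero_if_scaled[OF 1 \<beta>low])
  show "(\<lambda>k. \<beta> k *\<^sub>R (C *v dz k)) \<longlonglongrightarrow> 0"
    by (rule tendsto_zero_if_norm_power2) (use lim(4) in \<open>simp add: power_mult_distrib\<close>)
  obtain K where K: "\<And>u. quad Q u \<le> K * (norm u)\<^sup>2" using quad_bounded by blast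
  show "(\<lambda>k. \<beta> k *\<^sub>R (Q *v dz k)) \<longlonglongrightarrow> 0"
  proof (rule tendsto_zero_if_norm_power2, rule tendsto_sandwich[OF _ _ tendsto_const])
    show "eventually (\<lambda>k. (norm (\<beta> k *\<^sub>R (Q *v dz k)))\<^sup>2 \<le> K * ((\<beta> k)\<^sup>2 * quad Q (dz k))) sequentially"
      using mult_left_mono[OF norm_pos_semidef_mult_bound[OF Q K], of "(\<beta> k)\<^sup>2" "dz k" for k]
      by (simp add: power_mult_distrib mult_ac)
    show "(\<lambda>k. K * ((\<beta> k)\<^sup>2 * quad Q (dz k))) \<longlonglongrightarrow> 0"
      using tendsto_mult_left[OF lim(3), of K] by simp
  qed auto
  \<comment> \<open>Since \<open>\<beta> k P k\<close> is decreasing, its form is bounded uniformly in \<open>k\<close>.\<close>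
  obtain K0 where K0: "\<And>u. quad (\<beta> 0 *\<^sub>R P 0) u \<le> K0 * (norm u)\<^sup>2" using quad_bounded by blast
  show "(\<lambda>k. P k *v (y (Suc k) - y k)) \<longlonglongrightarrow> 0"
  proof (rule tendsto_zero_if_scaled[OF _ \<beta>low], rule tendsto_zero_if_norm_power2, rule tendsto_sandwich[OF _ _ tendsto_const])
    have Kk: "quad (\<beta> k *\<^sub>R P k) u \<le> K0 * (norm u)\<^sup>2" for k u
      using scaled_P_le_initial[of k u] K0[of u] by (simp add: quad_scaleR)
    have "pos_semidef (\<beta> k *\<^sub>R P k)" for k
      by (intro pos_semidef_scaleR P less_imp_le[OF \<beta>_pos])
    from norm_pos_semidef_mult_bound[OF this Kk]
    show "eventually (\<lambda>k. (norm (\<beta> k *\<^sub>R (P k *v (y (Suc k) - y k))))\<^sup>2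
            \<le> K0 * (\<beta> k * quad (P k) (y (Suc k) - y k))) sequentially"
      unfolding quad_scaleR scaleR_matrix_vector_assoc[symmetric] by simp
    show "(\<lambda>k. K0 * (\<beta> k * quad (P k) (y (Suc k) - y k))) \<longlonglongrightarrow> 0"
      using tendsto_mult_left[OF lim(2), of K0] by simp
  qed auto
  have "(\<lambda>k. z (Suc k) - zs) \<longlonglongrightarrow> 0"
  proof (rule tendsto_zero_if_norm_power2, rule tendsto_zero_if_scaled[OF _ \<beta>low])
    show "(\<lambda>k. \<beta> k *\<^sub>R (norm (z (Suc k) - zs))\<^sup>2) \<longlonglongrightarrow> 0" using lim(5) by simp
  qed
  then show "z \<longlonglongrightarrow> zs"
    by (rule LIMSEQ_imp_Suc[OF LIM_zero_cancel])
qed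

definition growth where "growth = \<sigma> / (2 * lambda_max D)"

lemma growth_pos: "0 < growth"
  using \<sigma> D_lambda_max_pos by (simp add: growth_def)

lemma \<beta>_Suc_le: "\<beta> (Suc k) \<le> \<beta> k + growth"
proof -
  have "(1 - \<epsilon>) * (\<sigma> * \<beta> k) \<le> 1 * (\<sigma> * \<beta> k)"
    using \<epsilon> \<sigma> \<beta>_pos[of k] by (intro mult_right_mono) auto
  then have "(1 - \<epsilon>) * \<sigma> * \<beta> k / lambda_max D \<le> \<sigma> * \<beta> k / lambda_max D"
    using D_lambda_max_pos by (intro divide_right_mono) auto
  also have "\<dots> = 2 * growth * \<beta> k" by (simp add: growth_def)
  finally have "(\<beta> (Suc k))\<^sup>2 \<le> (\<beta> k)\<^sup>2 + 2 * growth * \<beta> k + growth\<^sup>2"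
    using \<beta>_step_power2[of k] zero_le_power2[of growth] by linarith
  also have "\<dots> = (\<beta> k + growth)\<^sup>2" by (simp add: power2_sum)
  finally show ?thesis
    by (rule power2_le_imp_le) (use \<beta>_pos[of k] growth_pos in auto)
qed

lemma \<beta>_linear_growth: "\<beta> k \<le> (\<beta> 0 + growth) * real (Suc k)"
proof -
  have "\<beta> k \<le> \<beta> 0 + real k * growth"
  proof (induction k)
    case (Suc k)
    then show ?case using \<beta>_Suc_le[of k] by (simp add: algebra_simps)
  qed simp
  also have "\<dots> \<le> (\<beta> 0 + growth) * real (Suc k)"
    using \<beta>_pos[of 0] growth_pos by (simp add: algebra_simps)
  finally show ?thesis .
qed

text \<open>A bound for \<open>\<beta> (Suc k) / \<beta> k\<close>. The residual and the sum of the \<open>z\<close>-errors come with the weight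
  \<open>\<beta> k\<close>, the errors in the energy with \<open>\<beta> (Suc k)\<close>.\<close>

definition ratio where "ratio = 1 + growth / \<beta>low"

lemma \<beta>_Suc_le_ratio: "\<beta> (Suc k) \<le> ratio * \<beta> k"
proof -
  have "growth * 1 \<le> growth * (\<beta> k / \<beta>low)"
    using growth_pos \<beta>low by (intro mult_left_mono) auto
  then show ?thesis using \<beta>_Suc_le[of k] by (simp add: ratio_def algebra_simps)
qed

lemma \<beta>_Suc_power2_le: "(\<beta> (Suc k))\<^sup>2 \<le> ratio\<^sup>2 * (\<beta> k)\<^sup>2"
  using power_mono[OF \<beta>_Suc_le_ratio less_imp_le[OF \<beta>_pos], of k 2] by (simp add: power_mult_distrib)

text \<open>The energy contains no full norm of the \<open>y\<close>-error, only its \<open>P\<close>-part. The missing direction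
  \<open>\<beta>\<^sup>2 \<parallel>B (y - y\<^sup>*)\<parallel>\<^sup>2\<close> comes from the constraint: \<open>B (y - y\<^sup>*)\<close> is the residual minus \<open>C (z - z\<^sup>*)\<close>, and both of
  these occur in the energy with the weight \<open>\<beta>\<^sup>2\<close>. The matrix \<open>\<Theta>\<close> bounds the sum of the two from below
  uniformly in \<open>k\<close>. The convergence argument needs one \<open>M\<close> for all \<open>k\<close>.\<close>

lemma energy_controls_iterates:
  obtains M where "\<And>ys zs ls k. kkt_solution f g B C b (ys, zs, ls) \<Longrightarrow>
      (norm (y (Suc k) - ys))\<^sup>2 \<le> M * energy ys zs ls k
      \<and> (norm (l (Suc k) - ls))\<^sup>2 \<le> M * energy ys zs ls k"
proof -
  obtain c where c: "0 < c" "\<And>w. c * (norm w)\<^sup>2 \<le> quad \<Theta> w"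
    using pos_def_coercive[OF \<Theta>(1)] by blast
  have \<gamma>s: "0 < (\<gamma> - 1) * s" using \<gamma> s by simp
  define M where "M = (3 + 2 * ratio\<^sup>2 / ((\<gamma> - 1) * s)) / c + \<gamma>"
  have M: "0 \<le> (3 + 2 * ratio\<^sup>2 / ((\<gamma> - 1) * s)) / c" using c \<gamma>s by simp
  have "(norm (y (Suc k) - ys))\<^sup>2 \<le> M * energy ys zs ls k
      \<and> (norm (l (Suc k) - ls))\<^sup>2 \<le> M * energy ys zs ls k"
    if kkt: "kkt_solution f g B C b (ys, zs, ls)" for ys zs ls k
  proof -
    define E e h r where "E = energy ys zs ls k" "e = y (Suc k) - ys" "h = z (Suc k) - zs"
      "r = residual (Suc k)"
    note defs = this
    have E: "0 \<le> E" by (simp add: defs energy_nonneg)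
    have parts: "0 \<le> \<beta> (Suc k) * quad (P (Suc k)) e" "0 \<le> (\<beta> (Suc k))\<^sup>2 * (norm (C *v h))\<^sup>2"
      "0 \<le> (\<beta> (Suc k))\<^sup>2 * quad Q h"
      "0 \<le> (\<gamma> - 1) * s * ((\<beta> k)\<^sup>2 * (norm r)\<^sup>2)" "0 \<le> (\<beta> k)\<^sup>2 * quad Q (dz k)"
      "0 \<le> (norm (l (Suc k) - ls))\<^sup>2 / \<gamma>"
      using \<gamma> \<gamma>s less_imp_le[OF \<beta>_pos] quad_nonneg[OF P] quad_nonneg[OF Q] by simp_all
    have E_eq: "E = (norm (l (Suc k) - ls))\<^sup>2 / \<gamma> + \<beta> (Suc k) * quad (P (Suc k)) e
        + (\<beta> (Suc k))\<^sup>2 * (norm (C *v h))\<^sup>2 + (\<beta> (Suc k))\<^sup>2 * quad Q h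
        + (\<gamma> - 1) * s * ((\<beta> k)\<^sup>2 * (norm r)\<^sup>2) + (\<beta> k)\<^sup>2 * quad Q (dz k)"
      unfolding defs energy_def quad_D by (simp add: algebra_simps)
    have "B *v e = r - C *v h"
      using kkt[unfolded kkt_solution_iff] by (auto simp: defs residual_def matrix_vector_mult_diff_distrib)
    then have Be: "(norm (B *v e))\<^sup>2 \<le> 2 * (norm r)\<^sup>2 + 2 * (norm (C *v h))\<^sup>2"
      using norm_add_scaleR_power2[of r "-1" "C *v h"] norm_add_scaleR_power2[of r 1 "C *v h"]
        zero_le_power2[of "norm (r + C *v h)"] by simp
    have r: "(\<beta> (Suc k))\<^sup>2 * (norm r)\<^sup>2 \<le> ratio\<^sup>2 / ((\<gamma> - 1) * s) * E"
    proof -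
      have "(\<beta> (Suc k))\<^sup>2 * (norm r)\<^sup>2 \<le> (ratio\<^sup>2 * (\<beta> k)\<^sup>2) * (norm r)\<^sup>2"
        by (intro mult_right_mono \<beta>_Suc_power2_le) simp
      also have "\<dots> = ratio\<^sup>2 / ((\<gamma> - 1) * s) * ((\<gamma> - 1) * s * ((\<beta> k)\<^sup>2 * (norm r)\<^sup>2))"
        using \<gamma> s by auto
      also have "\<dots> \<le> ratio\<^sup>2 / ((\<gamma> - 1) * s) * E"
        using E_eq parts \<gamma>s by (intro mult_left_mono) auto
      finally show ?thesis .
    qed
    have "c * (norm e)\<^sup>2 \<le> \<beta> (Suc k) * quad (P (Suc k)) e + (\<beta> (Suc k))\<^sup>2 * (norm (B *v e))\<^sup>2"
      using c(2)[of e] loewner_leD[OF \<Theta>(2)[of "Suc k"], of e]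
      by (simp add: matrix_vector_mult_add_rdistrib inner_add_right quad_scaleR quad_gram)
    also have "\<dots> \<le> \<beta> (Suc k) * quad (P (Suc k)) e
        + (\<beta> (Suc k))\<^sup>2 * (2 * (norm r)\<^sup>2 + 2 * (norm (C *v h))\<^sup>2)"
      by (intro add_left_mono mult_left_mono Be) simp
    also have "\<dots> \<le> 3 * E + 2 * (ratio\<^sup>2 / ((\<gamma> - 1) * s) * E)"
      using r E_eq parts unfolding distrib_left by linarith
    finally have "(norm e)\<^sup>2 \<le> (3 + 2 * ratio\<^sup>2 / ((\<gamma> - 1) * s)) / c * E"
      using c(1) by (simp add: field_simps)
    also have "\<dots> \<le> M * E"
      using E \<gamma> by (intro mult_right_mono) (simp add: M_def)
    finally have "(norm e)\<^sup>2 \<le> M * E" .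
    moreover have "(norm (l (Suc k) - ls))\<^sup>2 / \<gamma> \<le> E"
      using E_eq parts by linarith
    then have "(norm (l (Suc k) - ls))\<^sup>2 \<le> \<gamma> * E"
      using \<gamma> by (simp add: divide_le_eq mult.commute)
    moreover have "\<gamma> * E \<le> M * E"
      using E M by (intro mult_right_mono) (simp add: M_def)
    ultimately show ?thesis by (simp add: defs)
  qed
  then show ?thesis using that by blast
qed

section \<open>Convergence\<close>

lemma energy_antimono:
  assumes "kkt_solution f g B C b (ys, zs, ls)" "j \<le> k"
  shows "energy ys zs ls k \<le> energy ys zs ls j"
  using assms(2)
proof (induction k rule: dec_induct)
  case (step n)
  then show ?case using energy_descent[OF assms(1), of n] decrease_parts(6)[of zs n] by linarith
qed simp

lemma bounded_iterates:
  assumes kkt: "kkt_solution f g B C b (ys, zs, ls)"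
  shows "bounded (range (\<lambda>k. (y (Suc k), l (Suc k))))"
proof -
  obtain M where M: "\<And>k. (norm (y (Suc k) - ys))\<^sup>2 \<le> M * energy ys zs ls k"
    "\<And>k. (norm (l (Suc k) - ls))\<^sup>2 \<le> M * energy ys zs ls k"
    using energy_controls_iterates kkt by metis
  define R where "R = \<bar>M\<bar> * energy ys zs ls 0"
  have R: "M * energy ys zs ls k \<le> R" for k
    unfolding R_def using energy_antimono[OF kkt, of 0 k] energy_nonneg[of ys zs ls k]
    by (intro mult_mono) auto
  have "norm (y (Suc k)) \<le> norm ys + sqrt R" "norm (l (Suc k)) \<le> norm ls + sqrt R" for k
    using norm_triangle_sub[of "y (Suc k)" ys] norm_triangle_sub[of "l (Suc k)" ls]
      real_le_rsqrt[OF order_trans[OF M(1) R], of k] real_le_rsqrt[OF order_trans[OF M(2) R], of k]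
    by linarith+
  then have "bounded (range (\<lambda>k. y (Suc k)))" "bounded (range (\<lambda>k. l (Suc k)))"
    unfolding bounded_iff by blast+
  from bounded_Times[OF this] show ?thesis
    by (rule bounded_subset) auto
qed

text \<open>The \<open>z\<close>-error is summable with weight \<open>\<beta>\<close> but enters the energy with weight \<open>\<beta>\<^sup>2\<close>, which may
  tend to infinity. As \<open>\<beta>\<close> grows at most linearly, the heavier weight can still be afforded along
  a subsequence.\<close>

lemma weighted_z_error_subsequence:
  assumes kkt: "kkt_solution f g B C b (ys, zs, ls)"
  obtains \<phi> where "\<And>j. j \<le> \<phi> j"
    "(\<lambda>j. (\<beta> (Suc (\<phi> j)))\<^sup>2 * (norm (z (Suc (\<phi> j)) - zs))\<^sup>2) \<longlonglongrightarrow> 0"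
proof -
  let ?a = "\<lambda>k. \<beta> k * (norm (z (Suc k) - zs))\<^sup>2"
  have "\<exists>k\<ge>j. \<beta> k * ?a k < inverse (real (Suc j))" for j
    by (rule frequently_small_if_linear_growth[OF summable_parts(5)[OF kkt] \<beta>_pos \<beta>_linear_growth]) simp
  then obtain \<phi> where \<phi>: "\<And>j. j \<le> \<phi> j" "\<And>j. \<beta> (\<phi> j) * ?a (\<phi> j) < inverse (real (Suc j))"
    by metis
  have le: "(\<beta> (Suc (\<phi> j)))\<^sup>2 * (norm (z (Suc (\<phi> j)) - zs))\<^sup>2 \<le> ratio\<^sup>2 * inverse (real (Suc j))" for j
  proof -
    have "(\<beta> (Suc (\<phi> j)))\<^sup>2 * (norm (z (Suc (\<phi> j)) - zs))\<^sup>2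
        \<le> (ratio\<^sup>2 * (\<beta> (\<phi> j))\<^sup>2) * (norm (z (Suc (\<phi> j)) - zs))\<^sup>2"
      by (intro mult_right_mono \<beta>_Suc_power2_le) simp
    also have "\<dots> = ratio\<^sup>2 * (\<beta> (\<phi> j) * ?a (\<phi> j))" by (simp add: power2_eq_square)
    also have "\<dots> \<le> ratio\<^sup>2 * inverse (real (Suc j))"
      using \<phi>(2)[of j] by (intro mult_left_mono) auto
    finally show ?thesis .
  qed
  have lim: "(\<lambda>j. ratio\<^sup>2 * inverse (real (Suc j))) \<longlonglongrightarrow> 0"
    using tendsto_mult_left[OF LIMSEQ_inverse_real_of_nat, of "ratio\<^sup>2"] by simp
  have "(\<lambda>j. (\<beta> (Suc (\<phi> j)))\<^sup>2 * (norm (z (Suc (\<phi> j)) - zs))\<^sup>2) \<longlonglongrightarrow> 0"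
    by (rule tendsto_sandwich[OF _ _ tendsto_const lim]) (use le in auto)
  with \<phi>(1) show ?thesis by (rule that)
qed

lemma kkt_cluster_point:
  assumes kkt: "kkt_solution f g B C b (ys, zs, ls)"
    and \<psi>: "filterlim \<psi> at_top sequentially"
    and y: "(\<lambda>j. y (Suc (\<psi> j))) \<longlonglongrightarrow> y'" and l: "(\<lambda>j. l (Suc (\<psi> j))) \<longlonglongrightarrow> l'"
  shows "kkt_solution f g B C b (y', zs, l')"
proof -
  note zero = tendsto_zero_parts[OF kkt, THEN filterlim_compose, OF \<psi>]
  note mv = bounded_linear.tendsto[OF matrix_vector_mul_bounded_linear]
  have z: "(\<lambda>j. z (Suc (\<psi> j))) \<longlonglongrightarrow> zs"
    by (rule filterlim_compose[OF LIMSEQ_Suc[OF tendsto_zero_parts(6)[OF kkt]] \<psi>])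
  \<comment> \<open>The optimality conditions contain the old multiplier, which has the same limit.\<close>
  have "(\<lambda>j. l (Suc (\<psi> j)) - \<gamma> *\<^sub>R (\<beta> (\<psi> j) *\<^sub>R residual (Suc (\<psi> j)))) \<longlonglongrightarrow> l' - \<gamma> *\<^sub>R 0"
    by (intro tendsto_intros l zero)
  then have l0: "(\<lambda>j. l (\<psi> j)) \<longlonglongrightarrow> l'" by (simp add: l_residual)
  have "(\<lambda>j. - (transpose B *v (l (\<psi> j) + (\<beta> (\<psi> j) *\<^sub>R residual (Suc (\<psi> j)) - \<beta> (\<psi> j) *\<^sub>R (C *v dz (\<psi> j))))
      + P (\<psi> j) *v (y (Suc (\<psi> j)) - y (\<psi> j)))) \<longlonglongrightarrow> - (transpose B *v (l' + (0 - 0)) + 0)"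
    by (intro tendsto_minus tendsto_add tendsto_diff mv zero l0)
  from subdiff_closed_graph[OF f(2) y this y_subgradient[unfolded scaleR_diff_right]]
  have "- (transpose B *v l') \<in> subdiff f y'" by simp
  moreover
  have "(\<lambda>j. - (transpose C *v (l (\<psi> j) + \<beta> (\<psi> j) *\<^sub>R residual (Suc (\<psi> j)))
      + \<beta> (\<psi> j) *\<^sub>R (Q *v dz (\<psi> j)))) \<longlonglongrightarrow> - (transpose C *v (l' + 0) + 0)"
    by (intro tendsto_minus tendsto_add mv zero l0)
  from subdiff_closed_graph[OF g(2) z this z_subgradient]
  have "- (transpose C *v l') \<in> subdiff g zs" by simp
  moreover have "(\<lambda>j. residual (Suc (\<psi> j))) \<longlonglongrightarrow> B *v y' + C *v zs - b"
    unfolding residual_def by (intro tendsto_intros mv y z)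
  then have "B *v y' + C *v zs - b = 0"
    using zero(2) by (rule LIMSEQ_unique)
  ultimately show ?thesis by (simp add: kkt_solution_iff)
qed

text \<open>The subsequence is chosen first so that the \<open>\<beta>\<^sup>2\<close>-weighted \<open>z\<close>-error vanishes and then
  refined so that \<open>y\<close> and \<open>l\<close> converge. The cluster point has the \<open>z\<close>-component \<open>zs\<close> again, so this
  error is also the one in the energy with respect to the cluster point, and the energy vanishes
  along the subsequence. Being monotone, it vanishes along the whole sequence.\<close>

theorem iterates_converge_to_kkt:
  assumes "kkt_solution f g B C b (ys, zs, ls)"
  shows "\<exists>ystar zstar lstar. kkt_solution f g B C b (ystar, zstar, lstar) \<and>
           (\<lambda>k. (y k, z k, l k)) \<longlonglongrightarrow> (ystar, zstar, lstar)"
proof -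
  note kkt = assms
  obtain \<phi> where \<phi>: "\<And>j. j \<le> \<phi> j"
    "(\<lambda>j. (\<beta> (Suc (\<phi> j)))\<^sup>2 * (norm (z (Suc (\<phi> j)) - zs))\<^sup>2) \<longlonglongrightarrow> 0"
    using weighted_z_error_subsequence[OF kkt] by blast
  have "bounded (range (\<lambda>j. (y (Suc (\<phi> j)), l (Suc (\<phi> j)))))"
    by (rule bounded_subset[OF bounded_iterates[OF kkt]]) auto
  then obtain \<rho> y' l' where \<rho>: "strict_mono \<rho>"
    and lim: "((\<lambda>j. (y (Suc (\<phi> j)), l (Suc (\<phi> j)))) \<circ> \<rho>) \<longlonglongrightarrow> (y', l')"
    using bounded_imp_convergent_subsequence by force
  define \<psi> where "\<psi> j = \<phi> (\<rho> j)" for j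
  have "j \<le> \<psi> j" for j
    using \<phi>(1)[of "\<rho> j"] seq_suble[OF \<rho>, of j] by (simp add: \<psi>_def)
  then have \<psi>: "filterlim \<psi> at_top sequentially"
    by (intro filterlim_at_top_mono[OF filterlim_ident]) auto
  have y': "(\<lambda>j. y (Suc (\<psi> j))) \<longlonglongrightarrow> y'" and l': "(\<lambda>j. l (Suc (\<psi> j))) \<longlonglongrightarrow> l'"
    using tendsto_fst[OF lim] tendsto_snd[OF lim] by (simp_all add: \<psi>_def o_def)
  have kkt': "kkt_solution f g B C b (y', zs, l')"
    by (rule kkt_cluster_point[OF kkt \<psi> y' l'])
  let ?E = "energy y' zs l'"
  have sub: "(\<lambda>j. ?E (\<psi> j)) \<longlonglongrightarrow> 0"
  proof (rule tendsto_sandwich[OF _ _ tendsto_const])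
    let ?u = "\<lambda>k. (norm (l (Suc k) - l'))\<^sup>2 / \<gamma> + \<beta> 0 * quad (P 0) (y (Suc k) - y')
      + lambda_max D * ((\<beta> (Suc k))\<^sup>2 * (norm (z (Suc k) - zs))\<^sup>2)
      + (\<gamma> - 1) * s * ((\<beta> k)\<^sup>2 * (norm (residual (Suc k)))\<^sup>2) + (\<beta> k)\<^sup>2 * quad Q (dz k)"
    have "?E k \<le> ?u k" for k
      using scaled_P_le_initial[of "Suc k" "y (Suc k) - y'"]
        mult_left_mono[OF quad_D_le[of "z (Suc k) - zs"], of "(\<beta> (Suc k))\<^sup>2"]
      unfolding energy_def by (simp add: mult_ac)
    then show "eventually (\<lambda>j. ?E (\<psi> j) \<le> ?u (\<psi> j)) sequentially" by simp
    have "(\<lambda>j. (norm (l (Suc (\<psi> j)) - l'))\<^sup>2 / \<gamma>) \<longlonglongrightarrow> (norm (l' - l'))\<^sup>2 / \<gamma>"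
      using \<gamma> by (intro tendsto_intros l') auto
    moreover have "(\<lambda>j. \<beta> 0 * quad (P 0) (y (Suc (\<psi> j)) - y')) \<longlonglongrightarrow> \<beta> 0 * quad (P 0) (y' - y')"
      by (intro tendsto_intros tendsto_quad y')
    moreover have "(\<lambda>j. (\<beta> (Suc (\<psi> j)))\<^sup>2 * (norm (z (Suc (\<psi> j)) - zs))\<^sup>2) \<longlonglongrightarrow> 0"
      using LIMSEQ_subseq_LIMSEQ[OF \<phi>(2) \<rho>] by (simp add: \<psi>_def o_def)
    from tendsto_mult_left[OF this, of "lambda_max D"]
    have "(\<lambda>j. lambda_max D * ((\<beta> (Suc (\<psi> j)))\<^sup>2 * (norm (z (Suc (\<psi> j)) - zs))\<^sup>2)) \<longlonglongrightarrow> 0"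
      by simp
    moreover note parts = summable_parts(1,3)[OF kkt', THEN summable_LIMSEQ_zero, THEN filterlim_compose, OF \<psi>]
    moreover have "(\<lambda>j. (\<gamma> - 1) * s * ((\<beta> (\<psi> j))\<^sup>2 * (norm (residual (Suc (\<psi> j))))\<^sup>2)) \<longlonglongrightarrow> 0"
      using tendsto_mult_left[OF parts(1), of "(\<gamma> - 1) * s"] by simp
    ultimately show "(\<lambda>j. ?u (\<psi> j)) \<longlonglongrightarrow> 0"
      by (simp add: tendsto_add_zero)
  qed (simp add: energy_nonneg)
  have E: "?E \<longlonglongrightarrow> 0"
  proof (rule LIMSEQ_I)
    fix \<delta> :: real assume "0 < \<delta>"
    with sub obtain j where "?E (\<psi> j) < \<delta>"
      by (metis eventually_sequentially order_refl order_tendstoD(2))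
    then have "norm (?E k - 0) < \<delta>" if "\<psi> j \<le> k" for k
      using energy_antimono[OF kkt' that] energy_nonneg[of y' zs l' k] by simp
    then show "\<exists>k0. \<forall>k\<ge>k0. norm (?E k - 0) < \<delta>" by blast
  qed
  obtain M where M: "\<And>k. (norm (y (Suc k) - y'))\<^sup>2 \<le> M * ?E k" "\<And>k. (norm (l (Suc k) - l'))\<^sup>2 \<le> M * ?E k"
    using energy_controls_iterates kkt' by metis
  have ME: "(\<lambda>k. M * ?E k) \<longlonglongrightarrow> 0" using tendsto_mult_left[OF E, of M] by simp
  have "(\<lambda>k. y (Suc k) - y') \<longlonglongrightarrow> 0"
    by (rule tendsto_zero_if_norm_power2[OF tendsto_sandwich[OF _ _ tendsto_const ME]]) (use M(1) in auto)
  then have y: "y \<longlonglongrightarrow> y'"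
    by (rule LIMSEQ_imp_Suc[OF LIM_zero_cancel])
  have "(\<lambda>k. l (Suc k) - l') \<longlonglongrightarrow> 0"
    by (rule tendsto_zero_if_norm_power2[OF tendsto_sandwich[OF _ _ tendsto_const ME]]) (use M(2) in auto)
  then have l: "l \<longlonglongrightarrow> l'"
    by (rule LIMSEQ_imp_Suc[OF LIM_zero_cancel])
  from kkt' tendsto_Pair[OF y tendsto_Pair[OF tendsto_zero_parts(6)[OF kkt] l]] show ?thesis
    by blast
qed

end

text \<open>The golden ratio is the positive root of \<open>\<gamma>\<^sup>2 - \<gamma> - 1\<close>, and \<open>(\<gamma> - 1)\<^sup>2 < 2 - \<gamma>\<close> says that this polynomial
  is negative at \<open>\<gamma>\<close>.\<close>

lemma golden_ratio_slack:
  fixes \<gamma> :: real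
  assumes "1 < \<gamma>" "\<gamma> < (1 + sqrt 5) / 2"
  obtains s where "\<gamma> - 1 < s" "(\<gamma> - 1) * s < 2 - \<gamma>"
proof -
  have "(2 * \<gamma> - 1)\<^sup>2 < (sqrt 5)\<^sup>2"
    using assms by (intro power_strict_mono) auto
  then have "(\<gamma> - 1) * (\<gamma> - 1) < 2 - \<gamma>"
    by (simp add: power2_eq_square algebra_simps)
  then have "\<gamma> - 1 < (2 - \<gamma>) / (\<gamma> - 1)"
    using assms by (simp add: pos_less_divide_eq)
  then obtain s where "\<gamma> - 1 < s" "s < (2 - \<gamma>) / (\<gamma> - 1)"
    using dense by blast
  then show ?thesis
    using that[of s] assms by (simp add: pos_less_divide_eq mult.commute)
qed

theorem theorem3p5:
  fixes f :: "real^'p \<Rightarrow> ereal" and g :: "real^'q \<Rightarrow> ereal"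
    and B :: "real^'p^'m" and C :: "real^'q^'m" and b :: "real^'m"
    and \<sigma>\<^sub>g \<gamma> \<epsilon> \<beta>low \<tau> :: real
    and Q :: "real^'q^'q" and P :: "nat \<Rightarrow> real^'p^'p" and \<Theta> :: "real^'p^'p"
    and \<beta> :: "nat \<Rightarrow> real"
    and y :: "nat \<Rightarrow> real^'p" and z :: "nat \<Rightarrow> real^'q" and l :: "nat \<Rightarrow> real^'m"
  assumes "proper_fun f" and "lsc_fun f" and "convex_fun f"
    and "proper_fun g" and "lsc_fun g" and "convex_fun g"
    and "\<sigma>\<^sub>g > 0" and "strongly_convex_fun \<sigma>\<^sub>g g"
    and "\<exists>w. kkt_solution f g B C b w"
    and "lambda_max (transpose C ** C + Q) > 0"
    and "iadmm_sequence f g B C b \<sigma>\<^sub>g \<gamma> \<epsilon> \<beta>low \<tau> Q P \<beta> y z l"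
    and "pos_def \<Theta>"
    and "\<forall>k\<ge>1. loewner_le \<Theta> (\<beta> k *\<^sub>R P k + (\<beta> k)\<^sup>2 *\<^sub>R (transpose B ** B))"
  shows "\<exists>ystar zstar lstar. kkt_solution f g B C b (ystar, zstar, lstar) \<and>
           (\<lambda>k. (y k, z k, l k)) \<longlonglongrightarrow> (ystar, zstar, lstar)"
proof -
  note seq = assms(11)[unfolded iadmm_sequence_def]
  obtain s where s: "\<gamma> - 1 < s" "(\<gamma> - 1) * s < 2 - \<gamma>"
    using golden_ratio_slack[of \<gamma>] seq by auto
  have low: "\<beta>low \<le> \<beta> (Suc k)" for k
    using seq by (cases k) auto
  interpret iadmm_iteration f g B C b \<sigma>\<^sub>g \<gamma> \<epsilon> \<beta>low s Q "\<lambda>k. P (Suc k)" \<Theta> "\<lambda>k. \<beta> (Suc k)"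
    "\<lambda>k. y (Suc k)" "\<lambda>k. z (Suc k)" "\<lambda>k. l (Suc k)"
    by unfold_locales (use assms(1-10,12,13) seq s low in auto)
  obtain ys zs ls where "kkt_solution f g B C b (ys, zs, ls)"
    using assms(9) by auto
  from iterates_converge_to_kkt[OF this] show ?thesis
    by (simp add: filterlim_sequentially_Suc[of "\<lambda>k. (y k, z k, l k)"])
qed

end
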